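(* Let $f(z)=\sum_{n=0}^{\infty}a_nz^n$ be a power series with $a_n\ge1$ for all $n\ge0$. Suppose there are constants $C>1$, $D>0$ and $\alpha\in[0,1)$ such that for every $n\ge0$, $$0\le C(n+1)-(a_0+\cdots+a_n)\le D(n+1)^{\alpha}.$$ For integers $k\ge1$ and $n$, let $a_{n,k}$ be the coefficient of $z^n$ in $f(z)^k$ (with $a_{n,k}=0$ for $n<0$), and let $$A:=\left(\frac{C}{C-1}\right)^{1/(2+\alpha)}.$$ Then for all sufficiently large $k$ and all integers $0\le n\le A^k/k^2$, we have $a_{n,k}^2\ge a_{n-1,k}\,a_{n+1,k}$. *)

theory Defs
  imports Complex_Main "HOL-Computational_Algebra.Formal_Power_Series"
begin

definition power_coeff :: "real fps \<Rightarrow> nat \<Rightarrow> int \<Rightarrow> real" where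
  "power_coeff f k n = (if n < 0 then 0 else fps_nth (f ^ k) (nat n))"

end

theory Submission
  imports Defs "HOL-Analysis.Analysis" "HOL-Real_Asymp.Real_Asymp"
begin

text \<open>
  Fix \<open>r \<in> (0, 1)\<close>. If the coefficients \<open>c\<^sub>j = a\<^bsub>j,k\<^esub> r\<^sup>j / f(r)\<^sup>k\<close> satisfy
  \<open>c\<^bsub>n-1\<^esub> + c\<^bsub>n+1\<^esub> \<le> 2 c\<^sub>n\<close>, then AM-GM gives log-concavity of \<open>a\<^bsub>n,k\<^esub>\<close> at \<open>n\<close>. So it is enough
  that the integral of \<open>Re ((f(r e\<^bsup>i\<theta>\<^esup>) / f(r))\<^sup>k e\<^bsup>-in\<theta>\<^esup>) (1 - cos \<theta>)\<close> over \<open>[0, \<pi>]\<close> is nonnegative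
  for the saddle point \<open>r\<close>, i.e. when the distribution \<open>a\<^sub>j r\<^sup>j / f(r)\<close> has mean \<open>n / k\<close>.
  Near \<open>\<theta> = 0\<close> the phase is of third order and the integrand is nonnegative. Elsewhere
  \<open>a\<^sub>j \<ge> 1\<close> makes the distribution a mixture with a geometric one of weight at least \<open>1 / C\<close>, which
  bounds \<open>|f(r e\<^bsup>i\<theta>\<^esup>)| / f(r)\<close>; for \<open>\<theta> \<ge> k\<^sup>2 (1 - r)\<close> this bound is \<open>(C - 1) / C + O(1/k\<^sup>2)\<close>, and
  Parseval saves another factor \<open>(1 - r)\<^bsup>1-\<alpha>\<^esup>\<close>. This settles all \<open>n\<close> above a constant; each of the
  remaining \<open>n\<close> is handled by the asymptotics of \<open>a\<^bsub>n,k\<^esub>\<close> as \<open>k \<longlonglongrightarrow> \<infinity>\<close>.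
\<close>

subsection \<open>Elementary inequalities\<close>

lemma one_minus_cos_eq: "1 - cos x = 2 * (sin (x / 2))\<^sup>2" for x :: real
  using cos_double_sin[of "x/2"] by simp

lemma one_minus_cos_le: "1 - cos x \<le> x\<^sup>2 / 2" for x :: real
proof -
  have "(sin (x/2))\<^sup>2 \<le> (x/2)\<^sup>2"
    using abs_sin_x_le_abs_x[of "x/2"] by (simp only: abs_le_square_iff)
  then show ?thesis unfolding one_minus_cos_eq by (simp add: power_divide)
qed

lemma sin_cubic: "\<bar>sin x - x\<bar> \<le> \<bar>x\<bar> ^ 3 / 6" for x :: real
proof -
  have "(\<Sum>m<3. sin_coeff m * x ^ m) = x"
    by (simp add: sin_coeff_def eval_nat_numeral)
  then show ?thesis
    using Maclaurin_sin_bound[of x 3] by (simp add: fact_numeral)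
qed

lemma one_minus_cos_ge:
  fixes x :: real
  assumes "0 \<le> x" "x \<le> pi"
  shows "x\<^sup>2 / 8 \<le> 1 - cos x"
proof -
  define y where "y = x / 2"
  have y: "0 \<le> y" "y \<le> 1.6" using assms pi_approx unfolding y_def by auto
  have "y^2 \<le> 1.6^2" by (rule power_mono) (use y in auto)
  then have "y * (y^2 / 6) \<le> y * (1/2)"
    by (intro mult_left_mono) (use y in \<open>auto simp: power2_eq_square\<close>)
  then have "y^3/6 \<le> y/2" by (simp add: power3_eq_cube power2_eq_square)
  moreover have "sin y \<ge> y - y^3/6" using sin_cubic[of y] y unfolding abs_le_iff by simp
  ultimately have "y/2 \<le> sin y" by simp
  then have "(y/2)\<^sup>2 \<le> (sin y)\<^sup>2" using y by (intro power_mono) auto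
  then show ?thesis unfolding one_minus_cos_eq y_def by (simp add: power_divide)
qed

lemma norm_one_minus_squared: "(norm (1 - of_real r * cis \<theta>))\<^sup>2 = (1 - r)\<^sup>2 + 2 * r * (1 - cos \<theta>)"
proof -
  have "(norm (1 - of_real r * cis \<theta>))\<^sup>2 = (1 - r * cos \<theta>)\<^sup>2 + (r * sin \<theta>)\<^sup>2"
    unfolding cmod_power2 by simp
  then show ?thesis by (simp add: power2_diff power_mult_distrib sin_squared_eq algebra_simps)
qed

lemma power_over_fact_le_exp:
  fixes x :: real
  assumes "0 \<le> x"
  shows "x ^ p / fact p \<le> exp x"
proof -
  have "(\<lambda>n. x ^ n /\<^sub>R fact n) sums exp x" by (rule exp_converges)
  then have "sum (\<lambda>n. x ^ n /\<^sub>R fact n) {p} \<le> exp x"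
    unfolding sums_iff using assms by (intro sum_le_suminf[of _ "{p}", THEN order_trans]) auto
  then show ?thesis by (simp add: divide_inverse mult.commute)
qed

lemma powr_exp_minus_le_one:
  fixes x \<alpha> :: real
  assumes "0 < x" "0 \<le> \<alpha>" "\<alpha> \<le> 1"
  shows "x powr \<alpha> * exp (- x) \<le> 1"
proof -
  have "x powr \<alpha> \<le> exp x"
  proof (cases "x \<le> 1")
    case True
    then have "x powr \<alpha> \<le> 1" using assms powr_mono2[of \<alpha> x 1] by simp
    also have "\<dots> \<le> exp x" using assms by simp
    finally show ?thesis .
  next
    case False
    then have "x powr \<alpha> \<le> x powr 1" using assms by (intro powr_mono) auto
    also have "\<dots> \<le> exp x" using assms exp_ge_add_one_self[of x] unfolding powr_one[OF less_imp_le[OF assms(1)]] by linarith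
    finally show ?thesis .
  qed
  then show ?thesis by (simp add: exp_minus field_simps)
qed

text \<open>Term by term this is the triangle inequality in the binomial expansion; the induction
  avoids the expansion.\<close>

lemma norm_power_one_plus_minus_one:
  fixes z :: complex
  shows "norm ((1 + z) ^ k - 1) \<le> (1 + norm z) ^ k - 1"
proof (induction k)
  case (Suc k)
  have "(1 + z) ^ Suc k - 1 = (1 + z) * ((1 + z) ^ k - 1) + z" by (simp add: algebra_simps)
  also have "norm \<dots> \<le> norm (1 + z) * norm ((1 + z) ^ k - 1) + norm z"
    by (metis norm_mult norm_triangle_ineq)
  also have "\<dots> \<le> (1 + norm z) * ((1 + norm z) ^ k - 1) + norm z"
    using Suc norm_triangle_ineq[of 1 z] by (intro add_mono mult_mono) auto
  finally show ?case by (simp add: algebra_simps)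
qed simp

lemma Re_complex_of_real_mult: "Re (complex_of_real x * z) = x * Re z"
  by simp

text \<open>Factoring out \<open>Re w\<close> leaves \<open>(1 + \<i> * x) ^ k\<close> with
  \<open>k * abs x <= 1 / 3\<close>, which lies within \<open>exp (1/3) - 1 <= 1/2\<close> of
  \<open>1\<close>. This controls the phase of a power without arguments or logarithms.\<close>

lemma Re_power_ge:
  fixes w :: complex
  assumes "Re w > 0" "\<bar>Im w\<bar> \<le> \<delta> * Re w" "real k * \<delta> \<le> 1 / 3"
  shows "Re (w ^ k) \<ge> Re w ^ k / 2"
proof -
  define x where "x = Im w / Re w"
  have w: "w = of_real (Re w) * (1 + \<i> * of_real x)"
    using assms(1) by (simp add: complex_eq_iff x_def)
  have x: "\<bar>x\<bar> \<le> \<delta>" using assms by (simp add: x_def field_simps)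
  have "norm ((1 + \<i> * of_real x) ^ k - 1) \<le> (1 + \<bar>x\<bar>) ^ k - 1"
    using norm_power_one_plus_minus_one[of "\<i> * of_real x" k] by (simp add: norm_mult)
  also have "(1 + \<bar>x\<bar>) ^ k \<le> exp \<bar>x\<bar> ^ k" by (intro power_mono) (auto simp: add.commute)
  also have "\<dots> = exp (real k * \<bar>x\<bar>)" by (simp add: exp_of_nat_mult)
  also have "\<dots> \<le> exp (1/3)"
    using order_trans[OF mult_left_mono[OF x, of "real k"] assms(3)] by simp
  also have "\<dots> \<le> 3/2" using exp_bound[of "1/3::real"] by (simp add: power2_eq_square)
  finally have "norm ((1 + \<i> * of_real x) ^ k - 1) \<le> 1/2" by simp
  then have "Re ((1 + \<i> * of_real x) ^ k) \<ge> 1/2"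
    using abs_Re_le_cmod[of "(1 + \<i> * of_real x) ^ k - 1"] by simp
  moreover have "w ^ k = of_real (Re w ^ k) * (1 + \<i> * of_real x) ^ k"
    by (subst w) (simp add: power_mult_distrib)
  ultimately show ?thesis
    using assms(1) mult_left_mono[of "1/2" "Re ((1 + \<i> * of_real x) ^ k)" "Re w ^ k"]
    by (simp only: Re_complex_of_real_mult) auto
qed

subsection \<open>Absolutely convergent Fourier series\<close>

text \<open>The radius is absorbed into \<open>c\<close>: for \<open>c j = a j * r ^ j\<close> this
  is the power series on the circle of radius \<open>r\<close>, and for a probability vector it is
  the characteristic function.\<close>

definition fourier :: "(nat \<Rightarrow> real) \<Rightarrow> real \<Rightarrow> complex" where
  "fourier c \<theta> = (\<Sum>j. of_real (c j) * cis (real j * \<theta>))"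

text \<open>The Weierstrass test makes the partial sums converge uniformly, so sum and integral can
  be exchanged; summability of \<open>I\<close> follows because the integrals of the partial sums
  converge.\<close>

lemma has_integral_suminf:
  fixes g :: "nat \<Rightarrow> real \<Rightarrow> real"
  assumes cont: "\<And>j. continuous_on {u..v} (g j)"
    and bnd: "\<And>j x. x \<in> {u..v} \<Longrightarrow> norm (g j x) \<le> M j" and M: "summable M"
    and I: "\<And>j. (g j has_integral I j) {u..v}"
  shows "((\<lambda>x. \<Sum>j. g j x) has_integral (\<Sum>j. I j)) {u..v}" "summable I"
proof -
  have u: "uniform_limit {u..v} (\<lambda>n x. \<Sum>j<n. g j x) (\<lambda>x. \<Sum>j. g j x) sequentially"
    by (rule Weierstrass_m_test[OF bnd M])
  obtain S J where S: "\<And>n. ((\<lambda>x. \<Sum>j<n. g j x) has_integral S n) {u..v}"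
    and J: "((\<lambda>x. \<Sum>j. g j x) has_integral J) {u..v}" and lim: "S \<longlonglongrightarrow> J"
    by (rule uniform_limit_integral[OF u]) (auto intro!: continuous_on_sum cont)
  have "S n = (\<Sum>j<n. I j)" for n
    using has_integral_unique[OF S[of n] has_integral_sum[of "{..<n}" g I "{u..v}"]] I by simp
  then have "S = (\<lambda>n. \<Sum>j<n. I j)" by (rule ext)
  then have "I sums J" using lim unfolding sums_def by (simp only:)
  with J show "((\<lambda>x. \<Sum>j. g j x) has_integral (\<Sum>j. I j)) {u..v}" "summable I"
    by (auto simp: sums_iff)
qed

lemma sin_nat_diff_pi: "sin ((real j - real n) * pi) = 0"
  unfolding left_diff_distrib sin_diff by simp

lemma has_integral_cos_nat_diff:
  "((\<lambda>\<theta>. cos ((real j - real n) * \<theta>)) has_integral (if j = n then pi else 0)) {0..pi}"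
proof (cases "j = n")
  case True
  then show ?thesis using has_integral_const_real[of "1::real" 0 pi] by simp
next
  case False
  define m where "m = real j - real n"
  have m: "m \<noteq> 0" using False by (simp add: m_def)
  have "((\<lambda>\<theta>. cos (m * \<theta>)) has_integral (sin (m * pi) / m - sin (m * 0) / m)) {0..pi}"
    by (rule fundamental_theorem_of_calculus)
      (use m in \<open>auto intro!: derivative_eq_intros simp flip: has_real_derivative_iff_has_vector_derivative\<close>)
  then show ?thesis using False by (simp add: m_def sin_nat_diff_pi)
qed

lemma summable_fourier:
  assumes "summable (\<lambda>j. \<bar>c j\<bar>)"
  shows "summable (\<lambda>j. of_real (c j) * cis (real j * \<theta>))"
  by (rule summable_norm_cancel) (use assms in \<open>simp add: norm_mult\<close>)

lemma norm_fourier_le: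
  assumes "summable (\<lambda>j. \<bar>c j\<bar>)"
  shows "norm (fourier c \<theta>) \<le> (\<Sum>j. \<bar>c j\<bar>)"
  unfolding fourier_def
  using summable_norm[of "\<lambda>j. of_real (c j) * cis (real j * \<theta>)"] assms by (simp add: norm_mult)

lemma continuous_on_fourier:
  assumes "summable (\<lambda>j. \<bar>c j\<bar>)"
  shows "continuous_on S (fourier c)"
proof -
  have "uniform_limit S (\<lambda>n x. \<Sum>j<n. of_real (c j) * cis (real j * x))
     (\<lambda>x. \<Sum>j. of_real (c j) * cis (real j * x)) sequentially"
    by (rule Weierstrass_m_test[OF _ assms]) (simp add: norm_mult)
  then show ?thesis unfolding fourier_def [abs_def]
    by (rule uniform_limit_theorem[rotated]) (auto intro!: always_eventually continuous_intros)
qed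

text \<open>The free factor \<open>w\<close> serves two purposes:
  \<open>cis (- (real n * \<theta>))\<close> extracts a coefficient, and
  \<open>cnj (fourier c \<theta>)\<close> leads to Parseval.\<close>

lemma Re_fourier_mult:
  assumes "summable (\<lambda>j. \<bar>c j\<bar>)"
  shows "(\<lambda>j. c j * Re (cis (real j * \<theta>) * w)) sums Re (fourier c \<theta> * w)"
proof -
  have "(\<lambda>j. of_real (c j) * cis (real j * \<theta>) * w) sums (fourier c \<theta> * w)"
    unfolding fourier_def by (intro sums_mult2 summable_sums summable_fourier assms)
  from sums_Re[OF this] show ?thesis by (simp add: algebra_simps)
qed

text \<open>Orthogonality of the cosines on \<open>{0..pi}\<close>; half the circle suffices because
  real coefficients make the integrand even.\<close>

lemma has_integral_fourier_coeff:
  assumes c: "summable (\<lambda>j. \<bar>c j\<bar>)"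
  shows "((\<lambda>\<theta>. Re (fourier c \<theta> * cis (- (real n * \<theta>)))) has_integral pi * c n) {0..pi}"
proof -
  have eq: "c j * Re (cis (real j * \<theta>) * cis (- (real n * \<theta>))) = c j * cos ((real j - real n) * \<theta>)" for j \<theta>
    by (simp add: cis_mult algebra_simps)
  have "((\<lambda>\<theta>. \<Sum>j. c j * cos ((real j - real n) * \<theta>)) has_integral (\<Sum>j. c j * (if j = n then pi else 0))) {0..pi}"
  proof (rule has_integral_suminf(1))
    show "summable (\<lambda>j. \<bar>c j\<bar>)" by fact
    show "norm (c j * cos ((real j - real n) * x)) \<le> \<bar>c j\<bar>" for j x
      by (simp add: abs_mult mult_left_le)
    show "((\<lambda>\<theta>. c j * cos ((real j - real n) * \<theta>)) has_integral c j * (if j = n then pi else 0)) {0..pi}" for j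
      by (intro has_integral_mult_right has_integral_cos_nat_diff)
  qed (auto intro!: continuous_intros)
  moreover have "(\<Sum>j. c j * (if j = n then pi else 0)) = pi * c n"
    using suminf_finite[of "{n}" "\<lambda>j. c j * (if j = n then pi else 0)"] by simp
  moreover have "(\<Sum>j. c j * cos ((real j - real n) * \<theta>)) = Re (fourier c \<theta> * cis (- (real n * \<theta>)))" for \<theta>
    using Re_fourier_mult[OF c, of \<theta> "cis (- (real n * \<theta>))"] unfolding eq by (simp add: sums_iff)
  ultimately show ?thesis by simp
qed

text \<open>Passing to the indices \<open>n - 1\<close> and \<open>n + 1\<close> multiplies by
  \<open>cis \<theta>\<close> and \<open>cis (- \<theta>)\<close>, whose mean is
  \<open>cos \<theta>\<close>.\<close>

lemma has_integral_fourier_second_difference: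
  assumes c: "summable (\<lambda>j. \<bar>c j\<bar>)" and n: "n \<ge> 1"
  shows "((\<lambda>\<theta>. Re (fourier c \<theta> * cis (- (real n * \<theta>))) * (1 - cos \<theta>))
            has_integral pi * (c n - (c (n - 1) + c (n + 1)) / 2)) {0..pi}"
proof -
  have *: "Re (w * cis (- (real n * \<theta>))) * (1 - cos \<theta>) = Re (w * cis (- (real n * \<theta>))) -
     (Re (w * cis (- (real (n - 1) * \<theta>))) + Re (w * cis (- (real (n + 1) * \<theta>)))) / 2" for w \<theta>
  proof -
    have 1: "- (real (n - 1) * \<theta>) = \<theta> + - (real n * \<theta>)" "- (real (n + 1) * \<theta>) = - \<theta> + - (real n * \<theta>)"
      using n by (simp_all add: of_nat_diff algebra_simps)
    define u where "u = w * cis (- (real n * \<theta>))"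
    have "w * cis (- (real (n - 1) * \<theta>)) = cis \<theta> * u" "w * cis (- (real (n + 1) * \<theta>)) = cis (- \<theta>) * u"
      unfolding 1 u_def cis_mult[symmetric] by (simp_all only: mult_ac)
    then show ?thesis unfolding u_def[symmetric] by (simp add: right_diff_distrib)
  qed
  have "((\<lambda>\<theta>. Re (fourier c \<theta> * cis (- (real n * \<theta>))) -
     (Re (fourier c \<theta> * cis (- (real (n - 1) * \<theta>))) + Re (fourier c \<theta> * cis (- (real (n + 1) * \<theta>)))) / 2)
     has_integral (pi * c n - (pi * c (n - 1) + pi * c (n + 1)) / 2)) {0..pi}"
    by (intro has_integral_diff has_integral_divide has_integral_add has_integral_fourier_coeff c)
  then show ?thesis unfolding * by (simp add: algebra_simps add_divide_distrib)
qed

text \<open>Parseval: one of the two factors is expanded into its series, and the coefficient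
  formula is applied to the other.\<close>

lemma has_integral_norm_fourier_squared:
  assumes c: "summable (\<lambda>j. \<bar>c j\<bar>)"
  shows "((\<lambda>\<theta>. (norm (fourier c \<theta>))\<^sup>2) has_integral pi * (\<Sum>j. (c j)\<^sup>2)) {0..pi}" "summable (\<lambda>j. (c j)\<^sup>2)"
proof -
  define M where "M = (\<Sum>j. \<bar>c j\<bar>)"
  let ?g = "\<lambda>j \<theta>. c j * Re (fourier c \<theta> * cis (- (real j * \<theta>)))"
  have g: "(\<lambda>j. ?g j \<theta>) sums (norm (fourier c \<theta>))\<^sup>2" for \<theta>
  proof -
    have "Re (cis (real j * \<theta>) * cnj w) = Re (w * cis (- (real j * \<theta>)))" for j w
      by (simp add: algebra_simps)
    with Re_fourier_mult[OF c, of \<theta> "cnj (fourier c \<theta>)"] show ?thesis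
      by (simp only: complex_norm_square[symmetric] Re_complex_of_real)
  qed
  have b: "norm (?g j x) \<le> \<bar>c j\<bar> * M" for j x
    using abs_Re_le_cmod[of "fourier c x * cis (- (real j * x))"] norm_fourier_le[OF c, of x]
    by (auto simp: abs_mult norm_mult M_def intro!: mult_left_mono)
  have I: "(?g j has_integral c j * (pi * c j)) {0..pi}" for j
    by (intro has_integral_mult_right has_integral_fourier_coeff c)
  have ct: "continuous_on {0..pi} (?g j)" for j
    by (intro continuous_intros continuous_on_fourier c)
  note hs = has_integral_suminf[OF ct b summable_mult2[OF c] I]
  have s: "summable (\<lambda>j. pi * (c j)\<^sup>2)" using hs(2) by (simp add: power2_eq_square mult_ac)
  then show s2: "summable (\<lambda>j. (c j)\<^sup>2)" using summable_mult_D by fastforce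
  have "(\<Sum>j. c j * (pi * c j)) = pi * (\<Sum>j. (c j)\<^sup>2)"
    using suminf_mult[OF s2, of pi] by (simp add: power2_eq_square mult_ac)
  then show "((\<lambda>\<theta>. (norm (fourier c \<theta>))\<^sup>2) has_integral pi * (\<Sum>j. (c j)\<^sup>2)) {0..pi}"
    using hs(1) g by (simp add: sums_iff)
qed

text \<open>The three claims share one induction: the Cauchy product in the step needs absolute
  convergence, which comes from nonnegativity and summability for the previous power.\<close>

lemma fourier_fps_power:
  fixes a :: "nat \<Rightarrow> real"
  assumes a: "\<And>j. a j \<ge> 0" and r: "r \<ge> 0" and s: "summable (\<lambda>j. a j * r ^ j)"
  shows "\<And>j. fps_nth (Abs_fps a ^ k) j \<ge> 0" "summable (\<lambda>j. fps_nth (Abs_fps a ^ k) j * r ^ j)"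
    "fourier (\<lambda>j. fps_nth (Abs_fps a ^ k) j * r ^ j) \<theta> = fourier (\<lambda>j. a j * r ^ j) \<theta> ^ k"
proof (induction k)
  case 0
  { case 1 show ?case by simp
  next
    case 2 show ?case by (rule summable_finite[of "{0}"]) auto
  next
    case 3 show ?case unfolding fourier_def by (subst suminf_finite[of "{0}"]) auto
  }
next
  case (Suc k)
  let ?b = "\<lambda>j. fps_nth (Abs_fps a ^ k) j * r ^ j"
  have nth: "fps_nth (Abs_fps a ^ Suc k) j * r ^ j = (\<Sum>i\<le>j. a i * r ^ i * ?b (j - i))" for j
    unfolding power_Suc fps_mult_nth fps_nth_Abs_fps sum_distrib_right atLeast0AtMost
  proof (intro sum.cong refl)
    fix i assume "i \<in> {..j}"
    then have "r ^ j = r ^ i * r ^ (j - i)" by (simp flip: power_add)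
    then show "a i * fps_nth (Abs_fps a ^ k) (j - i) * r ^ j = a i * r ^ i * ?b (j - i)"
      by simp
  qed
  have n1: "summable (\<lambda>j. norm (a j * r ^ j))" "summable (\<lambda>j. norm (?b j))"
    using s Suc(1,2) a r by auto
  { case 1 show ?case using Suc(1) a by (auto simp: fps_mult_nth intro!: sum_nonneg)
  next
    case 2 show ?case unfolding nth using Cauchy_product_sums[OF n1] by (simp add: sums_iff)
  next
    case 3
    have n2: "summable (\<lambda>j. norm (of_real (a j * r ^ j) * cis (real j * \<theta>)))"
       "summable (\<lambda>j. norm (of_real (?b j) * cis (real j * \<theta>)))"
      using n1 by (simp_all only: norm_mult norm_of_real norm_cis mult_1_right real_norm_def)
    have "of_real (\<Sum>i\<le>j. a i * r ^ i * ?b (j - i)) * cis (real j * \<theta>) =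
       (\<Sum>i\<le>j. of_real (a i * r ^ i) * cis (real i * \<theta>) * (of_real (?b (j - i)) * cis (real (j - i) * \<theta>)))" for j
      unfolding of_real_sum sum_distrib_right
    proof (intro sum.cong refl)
      fix i assume "i \<in> {..j}"
      then have "cis (real j * \<theta>) = cis (real i * \<theta>) * cis (real (j - i) * \<theta>)"
        by (simp add: cis_mult of_nat_diff flip: distrib_right)
      then show "of_real (a i * r ^ i * ?b (j - i)) * cis (real j * \<theta>) =
        of_real (a i * r ^ i) * cis (real i * \<theta>) * (of_real (?b (j - i)) * cis (real (j - i) * \<theta>))"
        by simp
    qed
    then show ?case unfolding nth
      using Cauchy_product_sums[OF n2] Suc(3) by (simp add: sums_iff fourier_def)
  }
qed

text \<open>The factor \<open>cis (- (m * \<theta>))\<close> centers the distribution at its mean.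
  This removes the first order term of the imaginary part and leaves a phase cubic in
  \<theta>.\<close>

lemma fourier_centered_bounds:
  fixes P :: "nat \<Rightarrow> real" and \<theta> :: real
  assumes P0: "\<And>j. P j \<ge> 0" and P1: "P sums 1"
    and m: "(\<lambda>j. real j * P j) sums m"
    and s2: "summable (\<lambda>j. real j ^ 2 * P j)" and s3: "summable (\<lambda>j. real j ^ 3 * P j)"
  shows "Re (fourier P \<theta> * cis (- (m * \<theta>))) \<ge> 1 - \<theta>\<^sup>2 / 2 * (\<Sum>j. real j ^ 2 * P j)"
    and "\<bar>Im (fourier P \<theta> * cis (- (m * \<theta>)))\<bar> \<le> \<bar>\<theta>\<bar> ^ 3 / 6 * ((\<Sum>j. real j ^ 3 * P j) + m ^ 3)"
proof -
  have abs: "summable (\<lambda>j. \<bar>P j\<bar>)" using P0 P1 by (simp add: sums_iff)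
  have m0: "m \<ge> 0" using sums_le[OF _ sums_zero m] P0 by simp
  have "(\<lambda>j. of_real (P j) * cis (real j * \<theta>) * cis (- (m * \<theta>))) sums (fourier P \<theta> * cis (- (m * \<theta>)))"
    unfolding fourier_def by (intro sums_mult2 summable_sums summable_fourier abs)
  then have *: "(\<lambda>j. of_real (P j) * cis ((real j - m) * \<theta>)) sums (fourier P \<theta> * cis (- (m * \<theta>)))"
    by (simp add: mult.assoc cis_mult left_diff_distrib)
  have re: "(\<lambda>j. P j * cos ((real j - m) * \<theta>)) sums Re (fourier P \<theta> * cis (- (m * \<theta>)))"
    using sums_Re[OF *] by simp
  have im: "(\<lambda>j. P j * sin ((real j - m) * \<theta>)) sums Im (fourier P \<theta> * cis (- (m * \<theta>)))"
    using sums_Im[OF *] by simp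
  \<comment> \<open>The bracket sums to the variance, which is bounded by the second moment further
    down.\<close>
  have "(\<lambda>j. P j - \<theta>\<^sup>2 / 2 * (real j ^ 2 * P j - 2 * m * (real j * P j) + m\<^sup>2 * P j)) sums
     (1 - \<theta>\<^sup>2 / 2 * ((\<Sum>j. real j ^ 2 * P j) - 2 * m * m + m\<^sup>2 * 1))"
    by (intro sums_add sums_diff sums_mult P1 m summable_sums s2)
  then have "1 - \<theta>\<^sup>2 / 2 * ((\<Sum>j. real j ^ 2 * P j) - 2 * m * m + m\<^sup>2 * 1)
      \<le> Re (fourier P \<theta> * cis (- (m * \<theta>)))"
  proof (rule sums_le[rotated, OF _ re])
    fix j
    have "1 - cos ((real j - m) * \<theta>) \<le> ((real j - m) * \<theta>)\<^sup>2 / 2" by (rule one_minus_cos_le)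
    then have "P j * (1 - ((real j - m) * \<theta>)\<^sup>2 / 2) \<le> P j * cos ((real j - m) * \<theta>)"
      by (intro mult_left_mono P0) linarith
    moreover have "P j - \<theta>\<^sup>2 / 2 * (real j ^ 2 * P j - 2 * m * (real j * P j) + m\<^sup>2 * P j)
      = P j * (1 - ((real j - m) * \<theta>)\<^sup>2 / 2)"
      by (simp add: power2_eq_square field_simps)
    ultimately show "P j - \<theta>\<^sup>2 / 2 * (real j ^ 2 * P j - 2 * m * (real j * P j) + m\<^sup>2 * P j)
        \<le> P j * cos ((real j - m) * \<theta>)" by simp
  qed
  moreover have "\<theta>\<^sup>2 / 2 * ((\<Sum>j. real j ^ 2 * P j) - 2 * m * m + m\<^sup>2 * 1) \<le> \<theta>\<^sup>2 / 2 * (\<Sum>j. real j ^ 2 * P j)"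
    by (intro mult_left_mono) (auto simp: power2_eq_square)
  ultimately show "Re (fourier P \<theta> * cis (- (m * \<theta>))) \<ge> 1 - \<theta>\<^sup>2 / 2 * (\<Sum>j. real j ^ 2 * P j)"
    by linarith
  \<comment> \<open>The subtracted series has sum \<open>0\<close>, so \<open>sin y\<close> may be
    replaced by \<open>sin y - y\<close>, which is of third order.\<close>
  have "(\<lambda>j. P j * sin ((real j - m) * \<theta>) - \<theta> * (real j * P j - m * P j)) sums
      (Im (fourier P \<theta> * cis (- (m * \<theta>))) - \<theta> * (m - m * 1))"
    by (intro sums_diff sums_mult P1 m im)
  then have im2: "(\<lambda>j. P j * (sin ((real j - m) * \<theta>) - (real j - m) * \<theta>)) sums Im (fourier P \<theta> * cis (- (m * \<theta>)))"
    by (simp add: algebra_simps)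
  have up: "(\<lambda>j. \<bar>\<theta>\<bar> ^ 3 / 6 * (real j ^ 3 * P j + m ^ 3 * P j)) sums
      (\<bar>\<theta>\<bar> ^ 3 / 6 * ((\<Sum>j. real j ^ 3 * P j) + m ^ 3 * 1))"
    by (intro sums_add sums_mult P1 summable_sums s3)
  have b: "\<bar>P j * (sin ((real j - m) * \<theta>) - (real j - m) * \<theta>)\<bar> \<le> \<bar>\<theta>\<bar> ^ 3 / 6 * (real j ^ 3 * P j + m ^ 3 * P j)" for j
  proof -
    have "\<bar>real j - m\<bar> ^ 3 \<le> max (real j) m ^ 3" using m0 by (intro power_mono) auto
    also have "\<dots> \<le> real j ^ 3 + m ^ 3" using m0 by (auto simp: max_def)
    finally have "\<bar>\<theta>\<bar> ^ 3 / 6 * \<bar>real j - m\<bar> ^ 3 \<le> \<bar>\<theta>\<bar> ^ 3 / 6 * (real j ^ 3 + m ^ 3)"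
      by (intro mult_left_mono) auto
    with sin_cubic[of "(real j - m) * \<theta>"]
    have "\<bar>sin ((real j - m) * \<theta>) - (real j - m) * \<theta>\<bar> \<le> \<bar>\<theta>\<bar> ^ 3 / 6 * (real j ^ 3 + m ^ 3)"
      by (simp add: abs_mult power_mult_distrib mult_ac)
    from mult_left_mono[OF this P0[of j]] have "P j * \<bar>sin ((real j - m) * \<theta>) - (real j - m) * \<theta>\<bar> \<le> P j * (\<bar>\<theta>\<bar> ^ 3 / 6 * (real j ^ 3 + m ^ 3))" .
    also have "\<dots> = \<bar>\<theta>\<bar> ^ 3 / 6 * (real j ^ 3 * P j + m ^ 3 * P j)" by (simp add: algebra_simps)
    finally show ?thesis unfolding abs_mult abs_of_nonneg[OF P0] .
  qed
  have "Im (fourier P \<theta> * cis (- (m * \<theta>))) \<le> \<bar>\<theta>\<bar> ^ 3 / 6 * ((\<Sum>j. real j ^ 3 * P j) + m ^ 3 * 1)"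
    using b abs_le_D1 by (intro sums_le[OF _ im2 up]) blast
  moreover have "- Im (fourier P \<theta> * cis (- (m * \<theta>))) \<le> \<bar>\<theta>\<bar> ^ 3 / 6 * ((\<Sum>j. real j ^ 3 * P j) + m ^ 3 * 1)"
    using b abs_le_D2 by (intro sums_le[OF _ sums_minus[OF im2] up]) blast
  ultimately show "\<bar>Im (fourier P \<theta> * cis (- (m * \<theta>)))\<bar> \<le> \<bar>\<theta>\<bar> ^ 3 / 6 * ((\<Sum>j. real j ^ 3 * P j) + m ^ 3)"
    by (simp only: abs_le_iff mult_1_right)
qed

subsection \<open>Power series with almost linear partial sums\<close>

text \<open>With \<open>t = (1 + r) / 2\<close>, the ratio \<open>r / t\<close> is at most
  \<open>exp (- (1 - r) / 2)\<close>, and this decay absorbs \<open>real j ^ p\<close>. The constant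
  is \<open>3 * 6 * 8 * 2\<close>: from \<open>exp x\<close>, \<open>fact p\<close>,
  \<open>2 ^ p\<close> and \<open>t ^ i \<le> 2 * t ^ j\<close>. One factor \<open>r\<close> is kept
  outside so that the moments are also small for small \<open>r\<close>.\<close>

lemma power_mult_geometric_le:
  fixes r :: real
  assumes r: "0 < r" "r < 1" and p: "1 \<le> p" "p \<le> 3"
  shows "real j ^ p * r ^ j \<le> 288 * r / (1 - r) ^ p * ((1 + r) / 2) ^ j"
proof (cases j)
  case 0
  then show ?thesis using r p by (simp add: power_0_left)
next
  case (Suc i)
  define x where "x = (1 - r) / 2"
  define t where "t = (1 + r) / 2"
  define u where "u = r / t"
  have x: "0 < x" "x \<le> 1" and t: "1/2 \<le> t" and u0: "0 \<le> u" using r by (auto simp: x_def t_def u_def)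
  have "0 \<le> (1 - r) * (1 - r)" by simp
  then have "u \<le> 1 - x" using r by (simp add: u_def t_def x_def field_simps)
  also have "\<dots> \<le> exp (- x)" using exp_ge_add_one_self[of "- x"] by simp
  finally have "u ^ i \<le> exp (- x) ^ i" using u0 by (intro power_mono)
  also have "\<dots> = exp x * exp (- (real j * x))"
    by (simp add: Suc algebra_simps flip: exp_of_nat_mult exp_add)
  also have "\<dots> \<le> 3 * exp (- (real j * x))"
    using x exp_le order_trans[of "exp x" "exp 1" 3] by (intro mult_right_mono) auto
  finally have u: "u ^ i \<le> 3 * exp (- (real j * x))" .
  have "(real j * x) ^ p / fact p \<le> exp (real j * x)"
    using x by (intro power_over_fact_le_exp) auto
  then have "(real j * x) ^ p \<le> fact p * exp (real j * x)" by (simp add: divide_le_eq mult.commute)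
  also have "fact p \<le> (6::real)"
    using fact_mono[OF p(2), where 'a=real] by (simp add: fact_numeral)
  finally have "(real j * x) ^ p \<le> 6 * exp (real j * x)" by simp
  then have e: "real j ^ p * exp (- (real j * x)) \<le> 6 / x ^ p"
    using x by (simp add: exp_minus field_simps power_mult_distrib)
  have "2 ^ p \<le> (2::real) ^ 3" using p by (intro power_increasing) auto
  then have p8: "2 ^ p \<le> (8::real)" by simp
  have rj: "r ^ j = r * (u ^ i * t ^ i)"
    using t by (simp add: Suc u_def flip: power_mult_distrib)
  have "t ^ i \<le> 2 * t ^ j" using t by (simp add: Suc)
  have "real j ^ p * u ^ i \<le> real j ^ p * (3 * exp (- (real j * x)))"
    by (intro mult_left_mono u) auto
  also have "\<dots> \<le> 18 / x ^ p" using e by simp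
  also have "\<dots> = 18 * 2 ^ p / (1 - r) ^ p" by (simp add: x_def power_divide)
  also have "\<dots> \<le> 144 / (1 - r) ^ p" using p8 r by (intro divide_right_mono) auto
  finally have "real j ^ p * u ^ i \<le> 144 / (1 - r) ^ p" .
  then have "r * ((real j ^ p * u ^ i) * t ^ i) \<le> r * (144 / (1 - r) ^ p * (2 * t ^ j))"
    using r t \<open>t ^ i \<le> 2 * t ^ j\<close> by (intro mult_left_mono mult_mono) auto
  then show ?thesis unfolding rj by (simp add: t_def mult_ac)
qed

locale almost_linear_sums =
  fixes a :: "nat \<Rightarrow> real" and C D \<alpha> :: real
  assumes coeff_ge_one: "a n \<ge> 1" and C_gt_one: "C > 1" and D_pos: "D > 0"
    and \<alpha>_nonneg: "0 \<le> \<alpha>" and \<alpha>_less_one: "\<alpha> < 1"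
    and sum_le: "(\<Sum>i\<le>n. a i) \<le> C * real (n + 1)"
    and sum_ge: "C * real (n + 1) - D * real (n + 1) powr \<alpha> \<le> (\<Sum>i\<le>n. a i)"
begin

lemma coeff_nonneg: "a n \<ge> 0"
  using coeff_ge_one[of n] by simp

text \<open>A coefficient is the difference of consecutive partial sums; the upper bound is used for
  the longer one and the lower bound for the shorter one.\<close>

lemma coeff_le: "a n \<le> C + D * real n powr \<alpha>"
proof (cases n)
  case 0
  \<comment> \<open>\<open>0 powr \<alpha>\<close> is \<open>0\<close> even for
    \<open>\<alpha> = 0\<close>, so the claim here is \<open>a 0 \<le> C\<close>.\<close>
  then show ?thesis using sum_le[of 0] D_pos by simp
next
  case (Suc i)
  then show ?thesis using sum_le[of n] sum_ge[of i] by (simp add: algebra_simps)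
qed

lemma summable_gf:
  assumes "0 \<le> r" "r < 1"
  shows "summable (\<lambda>j. a j * r ^ j)"
proof (rule summable_comparison_test')
  show "summable (\<lambda>j. C * (real (Suc j) * r ^ j))"
    using geometric_deriv_sums[of r] assms by (intro summable_mult) (auto simp: sums_iff)
  fix j
  have "a j \<le> (\<Sum>i\<le>j. a i)" using coeff_nonneg by (intro member_le_sum) auto
  then have "a j \<le> C * real (Suc j)" using sum_le[of j] by simp
  then show "norm (a j * r ^ j) \<le> C * (real (Suc j) * r ^ j)"
    using assms coeff_nonneg[of j] mult_right_mono[of "a j" "C * real (Suc j)" "r ^ j"] by simp
qed

definition gf :: "real \<Rightarrow> real" where
  "gf r = (\<Sum>j. a j * r ^ j)"

text \<open>Multiplying by the geometric series turns coefficients into partial sums, which are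
  compared with \<open>C\<close> times the series of \<open>1 / (1 - r)^2\<close>.\<close>

lemma gf_le:
  assumes "0 \<le> r" "r < 1"
  shows "gf r \<le> C / (1 - r)"
proof -
  have 1: "summable (\<lambda>j. norm (a j * r ^ j))" "summable (\<lambda>j. norm (r ^ j))"
    using summable_gf[OF assms] coeff_nonneg assms by auto
  have "(\<Sum>i\<le>j. a i * r ^ i * r ^ (j - i)) = (\<Sum>i\<le>j. a i) * r ^ j" for j
    by (simp add: sum_distrib_right mult.assoc flip: power_add)
  with Cauchy_product_sums[OF 1] have "(\<lambda>j. (\<Sum>i\<le>j. a i) * r ^ j) sums (gf r * (1 / (1 - r)))"
    using assms by (simp add: gf_def suminf_geometric)
  moreover have "(\<lambda>j. C * (real (Suc j) * r ^ j)) sums (C * (1 / (1 - r)\<^sup>2))"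
    using assms by (intro sums_mult geometric_deriv_sums) auto
  ultimately have "gf r * (1 / (1 - r)) \<le> C * (1 / (1 - r)\<^sup>2)"
    by (rule sums_le[rotated]) (use sum_le assms in \<open>auto simp flip: mult.assoc intro!: mult_right_mono\<close>)
  then have "gf r * (1 / (1 - r)) * (1 - r) \<le> C * (1 / (1 - r)\<^sup>2) * (1 - r)"
    using assms by (intro mult_right_mono) auto
  then show ?thesis using assms by (simp add: power2_eq_square)
qed

lemma gf_ge:
  assumes "0 \<le> r" "r < 1"
  shows "gf r \<ge> 1 / (1 - r)"
proof -
  have "(\<Sum>j. r ^ j) \<le> gf r"
    unfolding gf_def using assms coeff_ge_one
    by (intro suminf_le summable_gf) (auto simp: mult_le_cancel_right1 intro: summable_geometric)
  then show ?thesis using assms by (simp add: suminf_geometric)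
qed

lemma gf_pos: "0 \<le> r \<Longrightarrow> r < 1 \<Longrightarrow> gf r > 0"
  by (rule less_le_trans[OF _ gf_ge]) auto

section \<open>The tilted distribution: moments, saddle point and bounds for its characteristic
  function\<close>

definition prob :: "real \<Rightarrow> nat \<Rightarrow> real" where
  "prob r j = a j * r ^ j / gf r"

lemma prob_nonneg: "0 \<le> r \<Longrightarrow> r < 1 \<Longrightarrow> prob r j \<ge> 0"
  using gf_pos[of r] coeff_nonneg[of j] by (simp add: prob_def)

lemma prob_sums: "0 \<le> r \<Longrightarrow> r < 1 \<Longrightarrow> prob r sums 1"
  using sums_divide[OF summable_sums[OF summable_gf], of r "gf r"] gf_pos[of r]
  unfolding prob_def[abs_def] gf_def by simp

lemma summable_abs_prob: "0 \<le> r \<Longrightarrow> r < 1 \<Longrightarrow> summable (\<lambda>j. \<bar>prob r j\<bar>)"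
  using prob_sums[of r] prob_nonneg[of r] by (simp add: sums_iff)

text \<open>The weights at \<open>r\<close> are dominated by those at the midpoint \<open>t\<close>
  of \<open>r\<close> and \<open>1\<close>. The bound \<open>gf t \<le> C / (1 - t)\<close> equals
  \<open>2 * C / (1 - r)\<close> and is offset by \<open>gf r \<ge> 1 / (1 - r)\<close>; hence
  \<open>576 = 2 * 288\<close>.\<close>

lemma moment:
  assumes r: "0 < r" "r < 1" and p: "1 \<le> p" "p \<le> 3"
  shows "summable (\<lambda>j. real j ^ p * prob r j)"
    and "(\<Sum>j. real j ^ p * prob r j) \<le> 576 * C * r / (1 - r) ^ p"
proof -
  define t where "t = (1 + r) / 2"
  have t: "0 \<le> t" "t < 1" using r by (auto simp: t_def)
  define Q where "Q = 288 * r / (1 - r) ^ p / gf r"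
  have Q: "Q \<ge> 0" using r gf_pos[of r] by (simp add: Q_def)
  have b: "real j ^ p * prob r j \<le> Q * (a j * t ^ j)" for j
  proof -
    have "a j * (real j ^ p * r ^ j) \<le> a j * (288 * r / (1 - r) ^ p * t ^ j)"
      unfolding t_def by (intro mult_left_mono power_mult_geometric_le coeff_nonneg r p)
    then have "a j * (real j ^ p * r ^ j) / gf r \<le> a j * (288 * r / (1 - r) ^ p * t ^ j) / gf r"
      using r by (intro divide_right_mono less_imp_le[OF gf_pos]) auto
    then show ?thesis by (simp add: prob_def Q_def mult_ac)
  qed
  have s: "summable (\<lambda>j. Q * (a j * t ^ j))" by (intro summable_mult summable_gf t)
  show s': "summable (\<lambda>j. real j ^ p * prob r j)"
    by (rule summable_comparison_test'[OF s]) (use b prob_nonneg r in auto)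
  have "(\<Sum>j. real j ^ p * prob r j) \<le> Q * gf t"
    using suminf_le[OF b s' s] suminf_mult[OF summable_gf[OF t], of Q] by (simp add: gf_def)
  also have "\<dots> \<le> Q * (C / (1 - t))" by (intro mult_left_mono gf_le t Q)
  also have "\<dots> = 576 * C * r / (1 - r) ^ p * (1 / ((1 - r) * gf r))"
    using r by (simp add: Q_def t_def field_simps)
  also have "\<dots> \<le> 576 * C * r / (1 - r) ^ p * 1"
    using r C_gt_one gf_ge[of r] gf_pos[of r] by (intro mult_left_mono) (auto simp: field_simps)
  finally show "(\<Sum>j. real j ^ p * prob r j) \<le> 576 * C * r / (1 - r) ^ p" by simp
qed

text \<open>The numerator is bounded below through \<open>a j \<ge> 1\<close>, the denominator above
  through \<open>gf_le\<close>.\<close>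

lemma mean_ge:
  assumes r: "0 < r" "r < 1"
  shows "(\<Sum>j. real j * prob r j) \<ge> r / (C * (1 - r))"
proof -
  have "(\<lambda>n. r * (real (Suc n) * r ^ n) / gf r) sums (r * (1 / (1 - r)\<^sup>2) / gf r)"
    using r by (intro sums_mult sums_divide geometric_deriv_sums) auto
  then have "(\<lambda>n. real (Suc n) * r ^ (Suc n) / gf r) sums (r * (1 / (1 - r)\<^sup>2) / gf r)"
    by (simp add: mult_ac)
  then have g: "(\<lambda>n. real n * r ^ n / gf r) sums (r * (1 / (1 - r)\<^sup>2) / gf r)"
    by (subst (asm) sums_Suc_iff) simp
  have "r / (C * (1 - r)) = r * (1 / (1 - r)\<^sup>2) / (C / (1 - r))"
    using r C_gt_one by (simp add: power2_eq_square)
  also have "\<dots> \<le> r * (1 / (1 - r)\<^sup>2) / gf r"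
    using r C_gt_one gf_le[of r] gf_pos[of r] by (intro divide_left_mono) auto
  also have "\<dots> = (\<Sum>n. real n * r ^ n / gf r)" using g by (simp add: sums_iff)
  also have "\<dots> \<le> (\<Sum>j. real j * prob r j)"
  proof (rule suminf_le)
    show "real n * r ^ n / gf r \<le> real n * prob r n" for n
      using coeff_ge_one[of n] gf_pos[of r] r
      by (simp add: prob_def divide_right_mono mult_left_mono mult_le_cancel_right1)
    show "summable (\<lambda>j. real j * prob r j)" using moment(1)[of r 1] r by simp
  qed (use g in \<open>simp add: sums_iff\<close>)
  finally show ?thesis .
qed

text \<open>The intermediate value theorem is applied to \<open>h\<close>, the mean minus
  \<open>m\<close> with the denominator \<open>gf r\<close> cleared. As a power series,
  \<open>h\<close> is continuous also at \<open>0\<close>, where its value is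
  \<open>- m * a 0\<close>.\<close>

lemma saddle_point:
  assumes "m > 0"
  obtains r where "0 < r" "r < 1" "(\<lambda>j. real j * prob r j) sums m"
proof -
  define h where "h = (\<lambda>r. \<Sum>j. (real j - m) * a j * r ^ j)"
  have s: "summable (\<lambda>j. (real j - m) * a j * r ^ j)" if "0 < r" "r < 1" for r
  proof -
    have "summable (\<lambda>j. gf r * (real j ^ 1 * prob r j - m * prob r j))"
      using that prob_sums[of r] by (intro summable_mult summable_diff moment(1)) (auto simp: sums_iff)
    then show ?thesis using gf_pos[of r] that by (simp add: prob_def algebra_simps)
  qed
  have hr: "h r = gf r * ((\<Sum>j. real j * prob r j) - m)" if "0 < r" "r < 1" for r
  proof -
    have "(\<lambda>j. gf r * (real j * prob r j - m * prob r j)) sums (gf r * ((\<Sum>j. real j * prob r j) - m * 1))"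
      using that prob_sums[of r] moment(1)[of r 1]
      by (intro sums_mult sums_diff summable_sums) auto
    then show ?thesis using gf_pos[of r] that by (simp add: prob_def algebra_simps h_def sums_iff)
  qed
  \<comment> \<open>\<open>R\<close> solves \<open>R / (C * (1 - R)) = m\<close>, so
    \<open>mean_ge\<close> gives mean at least \<open>m\<close> at \<open>R\<close>.\<close>
  define R where "R = 1 - 1 / (1 + C * m)"
  have cm: "C * m > 0" using assms C_gt_one by simp
  have R: "0 < R" "R < 1" using cm by (auto simp: R_def field_simps)
  have "R = C * m * (1 - R)" using cm by (simp add: R_def field_simps add_pos_pos)
  then have "R / (C * (1 - R)) = m" using R C_gt_one by (simp add: nonzero_divide_eq_eq mult_ac)
  then have hR: "h R \<ge> 0" using mean_ge[OF R] gf_pos[of R] R unfolding hr[OF R] by simp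
  have h0: "h 0 < 0"
    unfolding h_def by (subst suminf_finite[of "{0}"]) (use assms coeff_ge_one[of 0] in auto)
  have "\<exists>x\<ge>0. x \<le> R \<and> h x = 0"
  proof (rule IVT)
    show "\<forall>x. 0 \<le> x \<and> x \<le> R \<longrightarrow> isCont h x"
    proof (intro allI impI)
      fix x assume "0 \<le> x \<and> x \<le> R"
      then show "isCont h x" unfolding h_def
        using R by (intro isCont_powser[OF s[of "(1 + R) / 2"]]) auto
    qed
  qed (use h0 hR R in auto)
  then obtain r where r: "0 \<le> r" "r \<le> R" "h r = 0" by blast
  with h0 have r': "0 < r" by (cases "r = 0") auto
  have r1: "r < 1" using r R by simp
  have "(\<lambda>j. real j * prob r j) sums (\<Sum>j. real j * prob r j)"
    using moment(1)[OF r' r1, of 1] by (simp add: summable_sums)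
  moreover have "(\<Sum>j. real j * prob r j) = m" using hr[OF r' r1] r gf_pos[of r] r1 by simp
  ultimately show ?thesis using that r' r1 by simp
qed

text \<open>Splitting \<open>a j = 1 + (a j - 1)\<close> separates the geometric series
  \<open>1 / (1 - z)\<close>. The nonnegative rest is bounded by its value at \<theta> = 0, so all
  the saving comes from the geometric part.\<close>

lemma norm_fourier_prob_le:
  assumes r: "0 < r" "r < 1"
  shows "norm (fourier (prob r) \<theta>) \<le> 1 - (1 - (1 - r) / norm (1 - of_real r * cis \<theta>)) / C"
proof -
  define z where "z = of_real r * cis \<theta>"
  have nz: "norm z = r" using r by (simp add: z_def norm_mult)
  have n1: "1 - r \<le> norm (1 - z)" using norm_triangle_ineq2[of 1 z] nz by simp
  have zj: "z ^ j = of_real (r ^ j) * cis (real j * \<theta>)" for j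
    by (simp add: z_def power_mult_distrib Complex.DeMoivre)
  have sg: "(\<lambda>j. z ^ j) sums (1 / (1 - z))" using nz r by (intro geometric_sums) simp
  have sb: "summable (\<lambda>j. (a j - 1) * r ^ j)"
    using summable_diff[OF summable_gf summable_geometric, of r r] r by (simp add: algebra_simps)
  have sf: "(\<lambda>j. of_real (prob r j) * cis (real j * \<theta>)) sums fourier (prob r) \<theta>"
    unfolding fourier_def by (intro summable_sums summable_fourier summable_abs_prob) (use r in auto)
  have g: "gf r > 0" using gf_pos r by simp
  have "(\<lambda>j. of_real (gf r) * (of_real (prob r j) * cis (real j * \<theta>)) - z ^ j) sums
     (of_real (gf r) * fourier (prob r) \<theta> - 1 / (1 - z))"
    by (intro sums_diff sums_mult sf sg)
  then have d: "(\<lambda>j. of_real ((a j - 1) * r ^ j) * cis (real j * \<theta>)) sums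
     (of_real (gf r) * fourier (prob r) \<theta> - 1 / (1 - z))"
    using g unfolding zj by (simp add: prob_def algebra_simps)
  have nrm: "norm (of_real ((a j - 1) * r ^ j) * cis (real j * \<theta>)) = (a j - 1) * r ^ j" for j
    unfolding norm_mult[of "of_real ((a j - 1) * r ^ j)"] norm_of_real norm_cis
    using coeff_ge_one[of j] r by simp
  have "norm (of_real (gf r) * fourier (prob r) \<theta> - 1 / (1 - z)) \<le> (\<Sum>j. norm (of_real ((a j - 1) * r ^ j) * cis (real j * \<theta>)))"
    unfolding sums_unique[OF d]
    by (intro summable_norm) (simp only: nrm sb)
  also have "\<dots> = (\<Sum>j. (a j - 1) * r ^ j)" by (simp only: nrm)
  also have "\<dots> = gf r - 1 / (1 - r)"
    using suminf_diff[OF summable_gf summable_geometric, of r r] r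
    by (simp add: algebra_simps suminf_geometric gf_def)
  finally have "norm (of_real (gf r) * fourier (prob r) \<theta> - 1 / (1 - z)) \<le> gf r - 1 / (1 - r)" .
  then have "norm (of_real (gf r) * fourier (prob r) \<theta>) \<le> gf r - 1 / (1 - r) + norm (1 / (1 - z))"
    using norm_triangle_ineq2[of "of_real (gf r) * fourier (prob r) \<theta>" "1 / (1 - z)"] by linarith
  then have "gf r * norm (fourier (prob r) \<theta>) \<le> gf r - 1 / (1 - r) + 1 / norm (1 - z)"
    using g by (simp add: norm_mult norm_divide)
  then have "norm (fourier (prob r) \<theta>) \<le> (gf r - 1 / (1 - r) + 1 / norm (1 - z)) / gf r"
    using g by (simp add: field_simps)
  also have "\<dots> = 1 - (1 / (1 - r)) * (1 - (1 - r) / norm (1 - z)) / gf r"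
  proof -
    define x where "x = 1 - r"
    have x: "x \<noteq> 0" using r by (simp add: x_def)
    show ?thesis unfolding x_def[symmetric]
      using g x by (simp add: diff_divide_distrib add_divide_distrib right_diff_distrib)
  qed
  \<comment> \<open>The bracket is nonnegative by \<open>n1\<close>, so enlarging
    \<open>gf r\<close> to \<open>C / (1 - r)\<close> weakens the bound.\<close>
  also have "\<dots> \<le> 1 - (1 / (1 - r)) * (1 - (1 - r) / norm (1 - z)) / (C / (1 - r))"
    using r n1 C_gt_one g gf_le[of r]
    by (intro diff_left_mono divide_left_mono mult_nonneg_nonneg mult_pos_pos) (auto simp: divide_le_eq_1)
  also have "(1 / (1 - r)) * (1 - (1 - r) / norm (1 - z)) / (C / (1 - r)) = (1 - (1 - r) / norm (1 - z)) / C"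
    using r C_gt_one by (simp add: field_simps)
  finally show ?thesis by (simp add: z_def)
qed

text \<open>The sum of squares is at most the largest weight, since the weights sum to
  \<open>1\<close>. That weight is controlled by \<open>coeff_le\<close> together with the bound
  \<open>(1 - r) powr (- \<alpha>)\<close> for \<open>real j powr \<alpha> * r ^ j\<close>.\<close>

lemma suminf_prob_squared_le:
  assumes r: "0 < r" "r < 1"
  shows "(\<Sum>j. (prob r j)\<^sup>2) \<le> (C + D) * (1 - r) powr (1 - \<alpha>)"
proof -
  have b: "prob r j \<le> (C + D) * (1 - r) powr (1 - \<alpha>)" for j
  proof -
    have one: "1 \<le> (1 - r) powr (- \<alpha>)" using r \<alpha>_nonneg powr_mono2'[of "-\<alpha>" "1 - r" 1] by simp
    have rj: "r ^ j \<le> exp (- (real j * (1 - r)))"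
    proof -
      have "r ^ j \<le> exp (- (1 - r)) ^ j" using r exp_ge_add_one_self[of "- (1 - r)"] by (intro power_mono) auto
      then show ?thesis by (simp only: exp_of_nat_mult[symmetric] mult_minus_right)
    qed
    have "real j powr \<alpha> * r ^ j \<le> (1 - r) powr (- \<alpha>)"
    proof (cases "j = 0")
      case True
      then show ?thesis using one by simp
    next
      case False
      have "real j powr \<alpha> = (real j * (1 - r)) powr \<alpha> * (1 - r) powr (- \<alpha>)"
        using r by (simp add: powr_mult powr_minus)
      then have "real j powr \<alpha> * r ^ j \<le> (1 - r) powr (- \<alpha>) * ((real j * (1 - r)) powr \<alpha> * exp (- (real j * (1 - r))))"
        using mult_left_mono[OF rj, of "(1 - r) powr (- \<alpha>) * (real j * (1 - r)) powr \<alpha>"] by (simp only: mult_ac) simp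
      also have "\<dots> \<le> (1 - r) powr (- \<alpha>) * 1"
        using False r \<alpha>_nonneg \<alpha>_less_one by (intro mult_left_mono powr_exp_minus_le_one) auto
      finally show ?thesis by simp
    qed
    then have "D * (real j powr \<alpha> * r ^ j) \<le> D * (1 - r) powr (- \<alpha>)" using D_pos by simp
    moreover have "C * r ^ j \<le> C * (1 - r) powr (- \<alpha>)"
      using one r C_gt_one power_le_one[of r j] by (intro mult_left_mono) auto
    moreover have "a j * r ^ j \<le> (C + D * real j powr \<alpha>) * r ^ j"
      using coeff_le r by (intro mult_right_mono) auto
    ultimately have *: "a j * r ^ j \<le> (C + D) * (1 - r) powr (- \<alpha>)" by (simp add: algebra_simps)
    have "prob r j \<le> a j * r ^ j / (1 / (1 - r))"
      unfolding prob_def using gf_ge[of r] gf_pos[of r] coeff_nonneg[of j] r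
      by (intro divide_left_mono) auto
    also have "\<dots> \<le> ((C + D) * (1 - r) powr (- \<alpha>)) * (1 - r)" using * r by (simp add: mult_right_mono)
    also have "\<dots> = (C + D) * (1 - r) powr (1 - \<alpha>)" using r by (simp add: powr_diff powr_minus field_simps)
    finally show ?thesis .
  qed
  have "(\<Sum>j. (prob r j)\<^sup>2) \<le> (\<Sum>j. (C + D) * (1 - r) powr (1 - \<alpha>) * prob r j)"
  proof (rule suminf_le)
    show "(prob r j)\<^sup>2 \<le> (C + D) * (1 - r) powr (1 - \<alpha>) * prob r j" for j
      using b[of j] prob_nonneg[of r j] r by (simp add: power2_eq_square mult_right_mono)
  qed (use r prob_sums[of r] in \<open>auto simp: sums_iff intro!: has_integral_norm_fourier_squared summable_abs_prob\<close>)
  also have "\<dots> = (C + D) * (1 - r) powr (1 - \<alpha>)"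
    using sums_mult[OF prob_sums[of r], of "(C + D) * (1 - r) powr (1 - \<alpha>)"] r by (simp add: sums_iff)
  finally show ?thesis .
qed

end

subsection \<open>Fixed coefficients of high powers\<close>

text \<open>Coefficients are compared in \<open>f * (X * (f ^ k)') = k * (X * f') * f ^ k\<close>,
  and the term \<open>j = 0\<close> on the left is isolated.\<close>

lemma fps_power_nth_recurrence:
  fixes a :: "nat \<Rightarrow> real"
  shows "real n * a 0 * fps_nth (Abs_fps a ^ k) n =
    (\<Sum>j=1..n. (real k * real j - real (n - j)) * a j * fps_nth (Abs_fps a ^ k) (n - j))"
proof -
  define f where "f = Abs_fps a"
  define B where "B = fps_nth (f ^ k)"
  have Xd: "fps_nth (fps_X * fps_deriv g) j = real j * fps_nth g j" for g j
    by (cases j) auto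
  have "fps_deriv (f ^ k) * f = of_nat k * fps_deriv f * f ^ k"
  proof (cases k)
    case (Suc i)
    show ?thesis unfolding Suc fps_deriv_power' diff_Suc_1 by (simp only: power_Suc mult_ac)
  qed simp
  then have "f * (fps_X * fps_deriv (f ^ k)) = of_nat k * ((fps_X * fps_deriv f) * f ^ k)"
    by (simp add: mult_ac)
  then have "fps_nth (f * (fps_X * fps_deriv (f ^ k))) n = fps_nth (of_nat k * ((fps_X * fps_deriv f) * f ^ k)) n"
    by (rule arg_cong)
  then have "(\<Sum>j=0..n. a j * (real (n - j) * B (n - j))) = real k * (\<Sum>j=0..n. real j * a j * B (n - j))"
    unfolding fps_mult_nth[of f] fps_mult_nth[of "fps_X * fps_deriv f"] fps_mult_of_nat_nth Xd
    by (simp add: f_def B_def)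
  then have "a 0 * (real n * B n) =
      (\<Sum>j=1..n. real k * (real j * a j * B (n - j))) - (\<Sum>j=1..n. a j * (real (n - j) * B (n - j)))"
    by (simp add: sum.atLeast_Suc_atMost[of 0 n] sum_distrib_left)
  also have "\<dots> = (\<Sum>j=1..n. (real k * real j - real (n - j)) * a j * B (n - j))"
    unfolding sum_subtractf[symmetric] by (intro sum.cong refl) (simp add: algebra_simps)
  finally show ?thesis by (simp add: f_def[symmetric] B_def[symmetric] mult_ac)
qed

text \<open>After scaling, the \<open>j\<close>-th term of the recurrence carries
  \<open>(1 / k) ^ (j - 1)\<close>, so only \<open>j = 1\<close> survives in the limit.\<close>

lemma fps_power_nth_asymptotics:
  fixes a :: "nat \<Rightarrow> real"
  assumes a0: "a 0 \<noteq> 0"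
  shows "(\<lambda>k. fps_nth (Abs_fps a ^ k) n / (a 0 ^ k * real k ^ n)) \<longlonglongrightarrow> (a 1 / a 0) ^ n / fact n"
proof (induction n rule: less_induct)
  case (less n)
  define b where "b = (\<lambda>k n. fps_nth (Abs_fps a ^ k) n / (a 0 ^ k * real k ^ n))"
  show ?case
  proof (cases n)
    case 0
    then show ?thesis using a0 by (simp add: fps_nth_power_0)
  next
    case (Suc i)
    \<comment> \<open>The factor \<open>0 ^ (j - 1)\<close> is \<open>1\<close> for
      \<open>j = 1\<close> and \<open>0\<close> otherwise, which lets one formula state all the
      limits.\<close>
    have lim: "(\<lambda>k. (real j - real (n - j) * (1 / real k)) * a j * b k (n - j) * (1 / real k) ^ (j - 1))
      \<longlonglongrightarrow> (real j - real (n - j) * 0) * a j * ((a 1 / a 0) ^ (n - j) / fact (n - j)) * 0 ^ (j - 1)"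
      if "j \<in> {1..n}" for j
    proof -
      have "(\<lambda>k. b k (n - j)) \<longlonglongrightarrow> (a 1 / a 0) ^ (n - j) / fact (n - j)"
        using less[of "n - j"] that by (simp add: b_def)
      then show ?thesis by (intro tendsto_intros lim_1_over_n)
    qed
    have rec: "b k n = (\<Sum>j=1..n. (real j - real (n - j) * (1 / real k)) * a j * b k (n - j) * (1 / real k) ^ (j - 1)) / (real n * a 0)"
      if k: "k > 0" for k
    proof -
      have "real n * a 0 * b k n = (\<Sum>j=1..n. (real k * real j - real (n - j)) * a j * fps_nth (Abs_fps a ^ k) (n - j)) / (a 0 ^ k * real k ^ n)"
        unfolding fps_power_nth_recurrence[symmetric] b_def by simp
      also have "\<dots> = (\<Sum>j=1..n. (real j - real (n - j) * (1 / real k)) * a j * b k (n - j) * (1 / real k) ^ (j - 1))"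
        unfolding sum_divide_distrib
      proof (intro sum.cong refl)
        fix j assume j: "j \<in> {1..n}"
        then have "real k ^ n = real k * real k ^ (j - 1) * real k ^ (n - j)"
          by (simp flip: power_add power_Suc)
        then show "(real k * real j - real (n - j)) * a j * fps_nth (Abs_fps a ^ k) (n - j) / (a 0 ^ k * real k ^ n) =
          (real j - real (n - j) * (1 / real k)) * a j * b k (n - j) * (1 / real k) ^ (j - 1)"
          using a0 k by (simp add: b_def field_simps)
      qed
      finally have *: "real n * a 0 * b k n = \<dots>" .
      have "real n * a 0 \<noteq> 0" using a0 Suc by simp
      with * show ?thesis by (simp only: nonzero_eq_divide_eq mult.commute[of "b k n"] not_False_eq_True)
    qed
    have "(\<lambda>k. (\<Sum>j=1..n. (real j - real (n - j) * (1 / real k)) * a j * b k (n - j) * (1 / real k) ^ (j - 1)) / (real n * a 0))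
      \<longlonglongrightarrow> (\<Sum>j=1..n. (real j - real (n - j) * 0) * a j * ((a 1 / a 0) ^ (n - j) / fact (n - j)) * 0 ^ (j - 1)) / (real n * a 0)"
      using Suc a0 by (intro tendsto_divide tendsto_sum lim) auto
    also have "(\<Sum>j=1..n. (real j - real (n - j) * 0) * a j * ((a 1 / a 0) ^ (n - j) / fact (n - j)) * 0 ^ (j - 1))
       = (\<Sum>j\<in>{1}. (real j - real (n - j) * 0) * a j * ((a 1 / a 0) ^ (n - j) / fact (n - j)) * 0 ^ (j - 1))"
      by (intro sum.mono_neutral_right) (use Suc in \<open>auto simp: power_0_left\<close>)
    also have "\<dots> / (real n * a 0) = (a 1 / a 0) ^ n / fact n"
      using Suc a0 by (simp add: field_simps)
    finally have "(\<lambda>k. b k n) \<longlonglongrightarrow> (a 1 / a 0) ^ n / fact n"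
      by (rule Lim_transform_eventually) (use rec in \<open>auto intro!: eventually_mono[OF eventually_gt_at_top[of 0]]\<close>)
    then show ?thesis by (simp add: b_def)
  qed
qed

text \<open>The scaled coefficients tend to \<open>c ^ n / fact n\<close>, which is strictly
  log-concave in \<open>n\<close>; strictness passes to all large \<open>k\<close> for this fixed
  \<open>n\<close>.\<close>

lemma eventually_fps_power_log_concave_at:
  fixes a :: "nat \<Rightarrow> real"
  assumes a: "a 0 > 0" "a 1 > 0" and n: "n \<ge> 1"
  shows "\<forall>\<^sub>F k in sequentially. fps_nth (Abs_fps a ^ k) (n - 1) * fps_nth (Abs_fps a ^ k) (n + 1)
    \<le> (fps_nth (Abs_fps a ^ k) n)\<^sup>2"
proof -
  obtain i where i: "n = Suc i" using n by (cases n) auto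
  define c where "c = a 1 / a 0"
  define b where "b = (\<lambda>k n. fps_nth (Abs_fps a ^ k) n / (a 0 ^ k * real k ^ n))"
  have lim: "(\<lambda>k. b k n) \<longlonglongrightarrow> c ^ n / fact n" for n
    using fps_power_nth_asymptotics[of a n] a by (simp add: b_def c_def)
  have c: "c > 0" using a by (simp add: c_def)
  have "(\<lambda>k. b k n * b k n - b k (n - 1) * b k (n + 1)) \<longlonglongrightarrow>
    c ^ n / fact n * (c ^ n / fact n) - c ^ (n - 1) / fact (n - 1) * (c ^ (n + 1) / fact (n + 1))"
    by (intro tendsto_intros lim)
  moreover have "c ^ n / fact n * (c ^ n / fact n) - c ^ (n - 1) / fact (n - 1) * (c ^ (n + 1) / fact (n + 1)) > 0"
  proof -
    have "fact (n - 1) * fact (n + 1) = fact n * fact n + fact i * fact i * (1 + real i)"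
      by (simp add: i algebra_simps)
    then have "fact n * fact n < (fact (n - 1) * fact (n + 1) :: real)" by simp
    then have "c ^ (2 * n) / (fact (n - 1) * fact (n + 1)) < c ^ (2 * n) / (fact n * fact n)"
      using c by (intro divide_strict_left_mono) auto
    moreover have "n - 1 + (n + 1) = n + n" using n by simp
    then have "c ^ n * c ^ n = c ^ (2 * n)" "c ^ (n - 1) * c ^ (n + 1) = c ^ (2 * n)"
      by (simp_all only: mult_2 power_add[symmetric])
    ultimately show ?thesis by (simp only: times_divide_times_eq diff_gt_0_iff_gt)
  qed
  ultimately have "\<forall>\<^sub>F k in sequentially. b k n * b k n - b k (n - 1) * b k (n + 1) > 0"
    by (rule order_tendstoD(1))
  then show ?thesis using eventually_gt_at_top[of 0]
  proof eventually_elim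
    case (elim k)
    define N where "N = a 0 ^ k * real k ^ n"
    have N: "N > 0" using a elim by (simp add: N_def)
    have b: "fps_nth (Abs_fps a ^ k) l = b k l * (a 0 ^ k * real k ^ l)" for l
      using a elim by (simp add: b_def)
    have "fps_nth (Abs_fps a ^ k) (n - 1) * fps_nth (Abs_fps a ^ k) (n + 1) = N\<^sup>2 * (b k (n - 1) * b k (n + 1))"
      unfolding b N_def by (simp add: i power2_eq_square)
    also have "\<dots> \<le> N\<^sup>2 * (b k n * b k n)" using elim by (intro mult_left_mono) auto
    also have "\<dots> = (fps_nth (Abs_fps a ^ k) n)\<^sup>2" using N by (simp add: b_def N_def[symmetric] power2_eq_square)
    finally show ?case .
  qed
qed

section \<open>Limits in \<open>k\<close> of the error terms for the middle and the far arc\<close>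

lemma tendsto_power8_mult_exp:
  fixes c :: real
  assumes "c > 0"
  shows "(\<lambda>k. real k ^ 8 * exp (- (real k / (4 * c))) / 6) \<longlonglongrightarrow> 0"
  using assms by real_asymp

lemma tendsto_power2_mult_power_plus:
  fixes q K M :: real
  assumes "0 < q" "q < 1"
  shows "(\<lambda>k. K * (real k ^ 2 * q ^ k + M / real k ^ 4)) \<longlonglongrightarrow> 0"
  using assms by real_asymp

subsection \<open>The saddle point estimate\<close>

context almost_linear_sums
begin

text \<open>With \<open>K = 576 C\<close> from \<open>moment\<close>, the \<open>p\<close>-th moment is at most \<open>K r / (1 - r)\<^sup>p\<close> and \<open>K + K\<^sup>3\<close> plays
  the same role for the third absolute central moment; \<open>\<kappa>\<close> makes the phase at most \<open>1 / 3\<close> on the central arc.\<close>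

definition \<kappa> :: real where
  "\<kappa> = 1 / (576 * C + (576 * C) ^ 3)"

lemma kappa_bounds: "0 < \<kappa>" "\<kappa> \<le> 1" "576 * C * \<kappa>\<^sup>2 \<le> 1" "(576 * C + (576 * C) ^ 3) * \<kappa> ^ 3 \<le> 1"
proof -
  define K where "K = 576 * C"
  define L where "L = K + K ^ 3"
  have K: "1 \<le> K" using C_gt_one by (simp add: K_def)
  have L: "K \<le> L" using K by (simp add: L_def)
  with K have L: "K \<le> L" "1 \<le> L" by linarith+
  have \<kappa>: "\<kappa> = 1 / L" by (simp add: \<kappa>_def L_def K_def)
  show "0 < \<kappa>" "\<kappa> \<le> 1" using L by (auto simp: \<kappa>)
  have "K * 1 \<le> L * L" using L K by (intro mult_mono) auto
  then have "K * \<kappa>\<^sup>2 \<le> 1" using L by (simp add: \<kappa> power2_eq_square field_simps)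
  then show "576 * C * \<kappa>\<^sup>2 \<le> 1" by (simp add: K_def)
  have "L * \<kappa> ^ 3 = \<kappa> ^ 2" using L by (simp add: \<kappa> power3_eq_cube power2_eq_square)
  also have "\<dots> \<le> 1" using \<open>0 < \<kappa>\<close> \<open>\<kappa> \<le> 1\<close> by (simp add: power_le_one)
  finally show "(576 * C + (576 * C) ^ 3) * \<kappa> ^ 3 \<le> 1" by (simp add: L_def K_def)
qed

text \<open>On the scale \<open>(1 - r) / w\<^sup>2\<close> the real part of the centered
  characteristic function is at least \<open>1 / 2\<close> and its imaginary part at most
  \<open>1 / (3 * k)\<close> of that, so \<open>Re_power_ge\<close> applies. On the smaller scale
  \<open>(1 - r) / w ^ 3\<close> the real part is at least \<open>1 - 1 / (2 * k)\<close>, and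
  Bernoulli's inequality keeps its \<open>k\<close>-th power above \<open>1 / 2\<close>.\<close>

lemma central_arc:
  assumes r: "0 < r" "r < 1" and k: "k \<ge> 1" and w: "w \<ge> 1" "w ^ 6 = real k * r"
    and m: "(\<lambda>j. real j * prob r j) sums m"
    and \<theta>: "0 \<le> \<theta>" "\<theta> \<le> \<kappa> * (1 - r) / w\<^sup>2"
  shows "Re ((fourier (prob r) \<theta> * cis (- (m * \<theta>))) ^ k) \<ge> 0"
    and "\<theta> \<le> \<kappa> * (1 - r) / w ^ 3 \<Longrightarrow> Re ((fourier (prob r) \<theta> * cis (- (m * \<theta>))) ^ k) \<ge> 1 / 4"
proof -
  define K where "K = 576 * C"
  define L where "L = K + K ^ 3"
  define \<psi> where "\<psi> = fourier (prob r) \<theta> * cis (- (m * \<theta>))"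
  have K: "1 \<le> K" using C_gt_one by (simp add: K_def)
  have L: "K \<le> L" using K by (simp add: L_def)
  with K have L: "K \<le> L" "1 \<le> L" by linarith+
  have \<kappa>: "0 < \<kappa>" "\<kappa> \<le> 1" "K * \<kappa>\<^sup>2 \<le> 1" "L * \<kappa> ^ 3 \<le> 1"
    using kappa_bounds by (simp_all add: K_def L_def)
  have m0: "0 \<le> m" using sums_le[OF _ sums_zero m] prob_nonneg[of r] r by simp
  have mle: "m \<le> K * r / (1 - r)" using moment(2)[of r 1] m r by (simp add: sums_iff K_def)
  note b = fourier_centered_bounds[OF prob_nonneg prob_sums m moment(1) moment(1), of \<theta>]
  have "\<theta>\<^sup>2 / 2 * (\<Sum>j. real j ^ 2 * prob r j) \<le> \<theta>\<^sup>2 / 2 * (K * r / (1 - r)\<^sup>2)"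
    using moment(2)[of r 2] r by (intro mult_left_mono) (auto simp: K_def)
  with b(1) have re: "Re \<psi> \<ge> 1 - \<theta>\<^sup>2 / 2 * (K * r / (1 - r)\<^sup>2)"
    using r by (simp add: \<psi>_def)
  have "m ^ 3 \<le> (K * r / (1 - r)) ^ 3" using m0 mle by (intro power_mono)
  also have "\<dots> = K ^ 3 * (r ^ 3 / (1 - r) ^ 3)" by (simp add: power_divide power_mult_distrib)
  also have "\<dots> \<le> K ^ 3 * (r / (1 - r) ^ 3)" using r K power_decreasing[of 1 3 r]
    by (intro mult_left_mono divide_right_mono) auto
  finally have "(\<Sum>j. real j ^ 3 * prob r j) + m ^ 3 \<le> L * r / (1 - r) ^ 3"
    using moment(2)[of r 3] r by (simp add: K_def L_def algebra_simps add_divide_distrib)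
  then have "\<bar>\<theta>\<bar> ^ 3 / 6 * ((\<Sum>j. real j ^ 3 * prob r j) + m ^ 3) \<le> \<bar>\<theta>\<bar> ^ 3 / 6 * (L * r / (1 - r) ^ 3)"
    by (intro mult_left_mono) auto
  moreover have "\<bar>Im \<psi>\<bar> \<le> \<bar>\<theta>\<bar> ^ 3 / 6 * ((\<Sum>j. real j ^ 3 * prob r j) + m ^ 3)"
    unfolding \<psi>_def using r by (intro b(2)) auto
  ultimately have im: "\<bar>Im \<psi>\<bar> \<le> \<theta> ^ 3 / 6 * (L * r / (1 - r) ^ 3)"
    unfolding abs_of_nonneg[OF \<theta>(1)] by (rule order_trans[rotated])
  \<comment> \<open>Used with \<open>v = w\<^sup>2\<close> for positivity and with
    \<open>v = w ^ 3\<close> for the quantitative bound.\<close>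
  have key2: "\<theta>\<^sup>2 / 2 * (K * r / (1 - r)\<^sup>2) \<le> r / (2 * v\<^sup>2)"
    if "\<theta> \<le> \<kappa> * (1 - r) / v" "v > 0" for v
  proof -
    have "\<theta>\<^sup>2 \<le> (\<kappa> * (1 - r) / v)\<^sup>2" using \<theta> that by (intro power_mono)
    then have "\<theta>\<^sup>2 / 2 * (K * r / (1 - r)\<^sup>2) \<le> (\<kappa> * (1 - r) / v)\<^sup>2 / 2 * (K * r / (1 - r)\<^sup>2)"
      using r K by (intro mult_right_mono) auto
    also have "\<dots> = (K * \<kappa>\<^sup>2) * (r / (2 * v\<^sup>2))"
      using r that by (simp add: power_divide power_mult_distrib mult_ac)
    also have "\<dots> \<le> 1 * (r / (2 * v\<^sup>2))" using \<kappa> r by (intro mult_right_mono) auto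
    finally show ?thesis by simp
  qed
  have "1 \<le> w ^ 4" using w by simp
  then have "r \<le> w ^ 4" using r by linarith
  then have "r / (2 * (w\<^sup>2)\<^sup>2) \<le> 1 / 2" using r w by (simp add: field_simps)
  moreover have "\<theta>\<^sup>2 / 2 * (K * r / (1 - r)\<^sup>2) \<le> r / (2 * (w\<^sup>2)\<^sup>2)"
    using \<theta> w by (intro key2) auto
  ultimately have re2: "Re \<psi> \<ge> 1 / 2" using re by linarith
  define \<delta> where "\<delta> = 1 / (3 * real k)"
  have "\<theta> ^ 3 \<le> (\<kappa> * (1 - r) / w\<^sup>2) ^ 3" using \<theta> by (intro power_mono)
  then have "\<theta> ^ 3 / 6 * (L * r / (1 - r) ^ 3) \<le> (\<kappa> * (1 - r) / w\<^sup>2) ^ 3 / 6 * (L * r / (1 - r) ^ 3)"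
    using r L by (intro mult_right_mono) auto
  also have "\<dots> = (L * \<kappa> ^ 3) * (r / (6 * w ^ 6))"
    using r w by (simp add: power_divide power_mult_distrib mult_ac)
  also have "\<dots> \<le> 1 * (r / (6 * w ^ 6))" using \<kappa> r w by (intro mult_right_mono) auto
  \<comment> \<open>The relation \<open>w ^ 6 = real k * r\<close> cancels \<open>r\<close> and
    produces the factor \<open>1 / k\<close> required of the phase.\<close>
  also have "\<dots> = \<delta> * (1 / 2)" unfolding w(2) using r k by (simp add: \<delta>_def)
  also have "\<dots> \<le> \<delta> * Re \<psi>" using re2 by (intro mult_left_mono) (auto simp: \<delta>_def)
  finally have "\<bar>Im \<psi>\<bar> \<le> \<delta> * Re \<psi>" using im by simp
  moreover have "real k * \<delta> \<le> 1 / 3" using k by (simp add: \<delta>_def)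
  ultimately have ge: "Re (\<psi> ^ k) \<ge> Re \<psi> ^ k / 2" using re2 by (intro Re_power_ge) auto
  then show "Re ((fourier (prob r) \<theta> * cis (- (m * \<theta>))) ^ k) \<ge> 0"
    using re2 order_trans[of 0 "Re \<psi> ^ k / 2"] by (simp add: \<psi>_def[symmetric])
  assume "\<theta> \<le> \<kappa> * (1 - r) / w ^ 3"
  then have "\<theta>\<^sup>2 / 2 * (K * r / (1 - r)\<^sup>2) \<le> r / (2 * (w ^ 3)\<^sup>2)" using w by (intro key2) auto
  also have "(w ^ 3)\<^sup>2 = real k * r" using w by (simp flip: power_mult)
  also have "r / (2 * (real k * r)) = 1 / (2 * real k)" using r by simp
  finally have "1 - 1 / (2 * real k) \<le> Re \<psi>" using re by simp
  moreover have k2: "1 / (2 * real k) \<le> 1" using k by simp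
  ultimately have "(1 + (- (1 / (2 * real k)))) ^ k \<le> Re \<psi> ^ k" by (intro power_mono) auto
  moreover have "1 + real k * (- (1 / (2 * real k))) \<le> (1 + (- (1 / (2 * real k)))) ^ k"
    using k2 by (intro Bernoulli_inequality) simp
  moreover have "1 + real k * (- (1 / (2 * real k))) = 1 / 2" using k by simp
  ultimately have "1 / 2 \<le> Re \<psi> ^ k" by linarith
  with ge show "Re ((fourier (prob r) \<theta> * cis (- (m * \<theta>))) ^ k) \<ge> 1 / 4"
    by (simp add: \<psi>_def[symmetric])
qed

text \<open>\<open>norm_fourier_prob_le\<close> gives \<open>1 - v / (4 * C)\<close> with
  \<open>v\<close> the minimum of a quadratic in \<theta> and \<open>1\<close>. Its
  \<open>k\<close>-th power is exponentially small, and the two exponentials on the right cover the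
  two cases of the minimum.\<close>

lemma norm_fourier_power_le:
  assumes r: "0 < r" "r < 1" and \<theta>: "0 \<le> \<theta>" "\<theta> \<le> pi"
  shows "norm (fourier (prob r) \<theta>) ^ k
    \<le> exp (- (real k * r * \<theta>\<^sup>2 / (16 * C * (1 - r)\<^sup>2))) + exp (- (real k / (4 * C)))"
proof -
  define y where "y = r * \<theta>\<^sup>2 / (4 * (1 - r)\<^sup>2)"
  define v where "v = min y 1"
  define N where "N = norm (1 - of_real r * cis \<theta>)"
  have y: "0 \<le> y" using r by (simp add: y_def)
  then have v: "0 \<le> v" "v \<le> 1" "v \<le> y" by (auto simp: v_def)
  \<comment> \<open>This is \<open>1 / sqrt (1 + v) <= 1 - v / 4\<close> on \<open>[0, 1]\<close>,
    squared and cleared of denominators.\<close>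
  have "1 \<le> 1 + v * (1 - v) / 2 + v\<^sup>2 / 16 + v ^ 3 / 16" using v by simp
  also have "\<dots> = (1 - v / 4)\<^sup>2 * (1 + v)" by (simp add: power2_eq_square power3_eq_cube field_simps)
  also have "\<dots> \<le> (1 - v / 4)\<^sup>2 * (1 + y)" using v by (intro mult_left_mono) auto
  finally have "(1 - r)\<^sup>2 * 1 \<le> (1 - r)\<^sup>2 * ((1 - v / 4)\<^sup>2 * (1 + y))" by (intro mult_left_mono) auto
  also have "\<dots> = (1 - v / 4)\<^sup>2 * ((1 - r)\<^sup>2 + r * \<theta>\<^sup>2 / 4)"
    using r by (simp add: y_def field_simps)
  also have "\<dots> \<le> (1 - v / 4)\<^sup>2 * N\<^sup>2"
    unfolding N_def norm_one_minus_squared using mult_left_mono[OF one_minus_cos_ge[OF \<theta>], of "2 * r"] r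
    by (intro mult_left_mono add_left_mono) auto
  finally have "(1 - r)\<^sup>2 \<le> ((1 - v / 4) * N)\<^sup>2" by (simp add: power_mult_distrib)
  then have "1 - r \<le> (1 - v / 4) * N"
    using v by (rule_tac power2_le_imp_le) (auto simp: N_def)
  moreover have "1 - r \<le> N"
    using norm_triangle_ineq2[of 1 "of_real r * cis \<theta>"] r by (simp add: N_def norm_mult)
  then have "N > 0" using r by linarith
  ultimately have "(1 - r) / N \<le> 1 - v / 4" by (simp add: field_simps)
  then have "v / 4 \<le> 1 - (1 - r) / N" by linarith
  then have "v / 4 / C \<le> (1 - (1 - r) / N) / C" using C_gt_one by (intro divide_right_mono) auto
  then have "norm (fourier (prob r) \<theta>) \<le> 1 - v / (4 * C)"
    using norm_fourier_prob_le[OF r, of \<theta>] by (simp add: N_def)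
  also have "\<dots> \<le> exp (- (v / (4 * C)))" using exp_ge_add_one_self[of "- (v / (4 * C))"] by simp
  finally have "norm (fourier (prob r) \<theta>) ^ k \<le> exp (- (v / (4 * C))) ^ k" by (intro power_mono) auto
  also have "\<dots> = exp (- (real k * v / (4 * C)))" by (simp flip: exp_of_nat_mult)
  also have "\<dots> \<le> exp (- (real k * y / (4 * C))) + exp (- (real k / (4 * C)))"
    by (cases "y \<le> 1") (auto simp: v_def min_def)
  also have "real k * y / (4 * C) = real k * r * \<theta>\<^sup>2 / (16 * C * (1 - r)\<^sup>2)"
    by (simp add: y_def mult_ac)
  finally show ?thesis .
qed

text \<open>Here \<open>(1 - r) / N\<close> is at most \<open>4 / k^2\<close>, so the norm exceeds
  \<open>(C - 1) / C\<close> by a factor \<open>1 + O(1 / k^2)\<close>, whose powers up to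
  \<open>k\<close> stay bounded. Two factors are left unestimated for Parseval.\<close>

lemma norm_fourier_power_le_far:
  assumes r: "0 < r" "r < 1" and k: "k \<ge> 4" and \<theta>: "real k ^ 2 * (1 - r) \<le> \<theta>" "\<theta> \<le> pi"
  shows "norm (fourier (prob r) \<theta>) ^ k
    \<le> ((C - 1) / C) ^ (k - 2) * exp (4 / (C - 1)) * (norm (fourier (prob r) \<theta>))\<^sup>2"
proof -
  define q where "q = (C - 1) / C"
  define N where "N = norm (1 - of_real r * cis \<theta>)"
  have q: "0 < q" using C_gt_one by (simp add: q_def)
  have k1: "real k \<ge> 4" using k by simp
  have \<theta>0: "0 < \<theta>" using \<theta> r k by (intro less_le_trans[OF _ \<theta>(1)]) simp
  \<comment> \<open>The arc is nonempty only if \<open>k^2 * (1 - r) <= pi < 4\<close>; with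
    \<open>k \<ge> 4\<close> this keeps \<open>r\<close> away from \<open>0\<close>.\<close>
  have "4 * 4 \<le> real k * real k" by (intro mult_mono k1) auto
  then have "16 * (1 - r) \<le> real k ^ 2 * (1 - r)" using r by (intro mult_right_mono) (auto simp: power2_eq_square)
  also have "\<dots> \<le> 4" using \<theta> pi_less_4 by simp
  finally have r2: "1 / 4 \<le> r" by simp
  have "(\<theta> / 4)\<^sup>2 = 2 * (1 / 4) * (\<theta>\<^sup>2 / 8)" by (simp add: power_divide)
  also have "\<dots> \<le> 2 * r * (1 - cos \<theta>)"
    using one_minus_cos_ge[of \<theta>] \<theta> \<theta>0 r r2 by (intro mult_mono) auto
  also have "\<dots> \<le> N\<^sup>2" unfolding N_def norm_one_minus_squared by simp
  finally have N: "\<theta> / 4 \<le> N" by (rule power2_le_imp_le) (simp add: N_def)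
  have "(1 - r) / N \<le> (1 - r) / (\<theta> / 4)" using N \<theta>0 r by (intro divide_left_mono) auto
  also have "\<dots> \<le> 4 / real k ^ 2" using \<theta>(1) \<theta>0 k by (simp add: field_simps)
  finally have "(1 - r) / N / C \<le> 4 / real k ^ 2 / C" using C_gt_one by (intro divide_right_mono) auto
  then have "norm (fourier (prob r) \<theta>) \<le> q + 4 / real k ^ 2 / C"
    using norm_fourier_prob_le[OF r, of \<theta>] C_gt_one by (simp add: N_def q_def diff_divide_distrib)
  also have "\<dots> = q * (1 + 4 / ((C - 1) * real k ^ 2))"
  proof -
    define d where "d = C - 1"
    have "d \<noteq> 0" using C_gt_one by (simp add: d_def)
    then show ?thesis unfolding q_def d_def[symmetric] by (simp add: distrib_left)
  qed
  also have "\<dots> \<le> q * exp (4 / ((C - 1) * real k ^ 2))" using q by (intro mult_left_mono) auto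
  finally have "norm (fourier (prob r) \<theta>) ^ (k - 2) \<le> (q * exp (4 / ((C - 1) * real k ^ 2))) ^ (k - 2)"
    by (intro power_mono) auto
  also have "\<dots> = q ^ (k - 2) * exp (real (k - 2) * (4 / ((C - 1) * real k ^ 2)))"
    by (simp only: power_mult_distrib exp_of_nat_mult)
  also have "\<dots> \<le> q ^ (k - 2) * exp (4 / (C - 1))"
  proof -
    have "real k * 1 \<le> real k * real k" using k1 by (intro mult_left_mono) auto
    moreover have "real (k - 2) \<le> real k" by simp
    ultimately have "real (k - 2) \<le> real k * real k" by linarith
    then have "real (k - 2) * (4 / ((C - 1) * real k ^ 2)) \<le> real k ^ 2 * (4 / ((C - 1) * real k ^ 2))"
      using C_gt_one by (intro mult_right_mono) (auto simp: power2_eq_square)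
    also have "\<dots> = 4 / (C - 1)" using k by simp
    finally show ?thesis using q by (intro mult_left_mono) auto
  qed
  finally have "norm (fourier (prob r) \<theta>) ^ (k - 2) * (norm (fourier (prob r) \<theta>))\<^sup>2
     \<le> q ^ (k - 2) * exp (4 / (C - 1)) * (norm (fourier (prob r) \<theta>))\<^sup>2"
    by (rule mult_right_mono) simp
  moreover have "norm (fourier (prob r) \<theta>) ^ (k - 2) * (norm (fourier (prob r) \<theta>))\<^sup>2 = norm (fourier (prob r) \<theta>) ^ k"
  proof -
    have "k - 2 + 2 = k" using k by simp
    then show ?thesis by (simp only: power_add[symmetric])
  qed
  ultimately show ?thesis by (simp add: q_def)
qed

end

section \<open>Normalization and integrals for the minorant of the saddle point integrand\<close>

lemma fourier_divide:
  assumes "summable (\<lambda>j. \<bar>c j\<bar>)"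
  shows "fourier (\<lambda>j. c j / g) \<theta> = fourier c \<theta> / of_real g"
  using suminf_divide[OF summable_fourier[OF assms], of \<theta> "of_real g"] by (simp add: fourier_def)

text \<open>The cut-off is written into the integrand so that all pieces of the minorant can be
  integrated over one interval.\<close>

lemma has_integral_power2_restrict:
  fixes b d :: real
  assumes "0 \<le> b" "b \<le> d"
  shows "((\<lambda>x. if x \<in> {0..b} then c * x\<^sup>2 else 0) has_integral c * b ^ 3 / 3) {0..d}"
proof -
  have "((\<lambda>x. c * x\<^sup>2) has_integral (c * b ^ 3 / 3 - c * 0 ^ 3 / 3)) {0..b}"
    using assms by (intro fundamental_theorem_of_calculus)
      (auto intro!: derivative_eq_intros simp flip: has_real_derivative_iff_has_vector_derivative)
  then show ?thesis using assms by (subst has_integral_restrict) auto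
qed

lemma has_integral_inverse_power4_restrict:
  fixes b d :: real
  assumes "0 < b" "b \<le> d"
  shows "((\<lambda>x. if x \<in> {b..d} then c / x ^ 4 else 0) has_integral c / (3 * b ^ 3) - c / (3 * d ^ 3)) {0..d}"
proof -
  have "((\<lambda>x. c / x ^ 4) has_integral (- (c / (3 * d ^ 3)) - (- (c / (3 * b ^ 3))))) {b..d}"
  proof (rule fundamental_theorem_of_calculus)
    fix x assume "x \<in> {b..d}"
    then have "((\<lambda>x. - (c / (3 * x ^ 3))) has_real_derivative c / x ^ 4) (at x within {b..d})"
      using assms by (auto intro!: derivative_eq_intros simp: field_simps eval_nat_numeral)
    then show "((\<lambda>x. - (c / (3 * x ^ 3))) has_vector_derivative c / x ^ 4) (at x within {b..d})"
      by (simp add: has_real_derivative_iff_has_vector_derivative)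
  qed (use assms in auto)
  then show ?thesis using assms by (subst has_integral_restrict) auto
qed

context almost_linear_sums
begin

text \<open>\<open>c\<close> is the law of a sum of \<open>k\<close> independent variables
  distributed as \<open>prob r\<close>, which explains the \<open>k\<close>-th power.\<close>

lemma fourier_power_normalized:
  fixes k :: nat
  assumes r: "0 < r" "r < 1"
  defines "c \<equiv> \<lambda>j. fps_nth (Abs_fps a ^ k) j * r ^ j / gf r ^ k"
  shows "summable (\<lambda>j. \<bar>c j\<bar>)" "fourier c \<theta> = fourier (prob r) \<theta> ^ k"
proof -
  have g: "gf r > 0" using r by (intro gf_pos) auto
  let ?A = "\<lambda>j. fps_nth (Abs_fps a ^ k) j * r ^ j"
  have A0: "0 \<le> ?A j" for j
    using fourier_fps_power(1)[of a r k] coeff_nonneg r summable_gf[of r] by simp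
  have A: "summable ?A" "fourier ?A \<theta> = fourier (\<lambda>j. a j * r ^ j) \<theta> ^ k"
    using fourier_fps_power(2,3)[of a r] coeff_nonneg r summable_gf[of r] by auto
  have absA: "summable (\<lambda>j. \<bar>?A j\<bar>)" using A(1) by (simp only: abs_of_nonneg[OF A0])
  have c0: "\<bar>c j\<bar> = ?A j / gf r ^ k" for j
    unfolding c_def using A0[of j] g by simp
  show "summable (\<lambda>j. \<bar>c j\<bar>)" unfolding c0 using A(1) by (rule summable_divide)
  have "fourier (prob r) \<theta> = fourier (\<lambda>j. a j * r ^ j) \<theta> / of_real (gf r)"
    unfolding prob_def[abs_def] using summable_gf[of r] r coeff_nonneg by (intro fourier_divide) simp
  then show "fourier c \<theta> = fourier (prob r) \<theta> ^ k"
    unfolding c_def fourier_divide[OF absA] A(2) by (simp add: power_divide)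
qed

text \<open>Here \<open>w = (k r)\<^bsup>1/6\<^esup>\<close>: the integrand is nonnegative up to \<open>\<kappa> (1 - r) / w\<^sup>2\<close>, and its main
  mass lies below the standard scale \<open>(1 - r) / w\<^sup>3\<close>. The minorant \<open>h\<close> replaces the Gaussian
  \<open>exp (-V)\<close> by \<open>6 / V\<^sup>3\<close>, which is integrable in closed form.\<close>

lemma second_difference_nonpos:
  assumes r: "0 < r" "r < 1" and k: "k \<ge> 4" and w: "w \<ge> 1" "w ^ 6 = real k * r"
    and n: "n \<ge> 1" and mean: "(\<lambda>j. real j * prob r j) sums (real n / real k)"
    and w_large: "288 * 4096 * C ^ 3 / \<kappa> ^ 6 \<le> w ^ 3"
    and exp_small: "real k ^ 8 * exp (- (real k / (4 * C))) / 6 \<le> \<kappa> ^ 3 / 288"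
    and tail_small: "8 * (((C - 1) / C) ^ (k - 2) * exp (4 / (C - 1))) * (C + D) * real k ^ 2 * (1 - r) powr (- (2 + \<alpha>)) \<le> \<kappa> ^ 3 / 288"
  shows "fps_nth (Abs_fps a ^ k) (n - 1) * r ^ (n - 1) + fps_nth (Abs_fps a ^ k) (n + 1) * r ^ (n + 1)
    \<le> 2 * (fps_nth (Abs_fps a ^ k) n * r ^ n)"
proof -
  define c where "c = (\<lambda>j. fps_nth (Abs_fps a ^ k) j * r ^ j / gf r ^ k)"
  have c: "summable (\<lambda>j. \<bar>c j\<bar>)" "fourier c \<theta> = fourier (prob r) \<theta> ^ k" for \<theta>
    unfolding c_def by (rule fourier_power_normalized[OF r])+
  define \<psi> where "\<psi> \<theta> = fourier (prob r) \<theta> * cis (- (real n / real k * \<theta>))" for \<theta>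
  define g where "g \<theta> = Re (\<psi> \<theta> ^ k) * (1 - cos \<theta>)" for \<theta>
  have \<psi>: "fourier c \<theta> * cis (- (real n * \<theta>)) = \<psi> \<theta> ^ k" for \<theta>
    using k by (simp add: c(2) \<psi>_def power_mult_distrib Complex.DeMoivre)
  have J: "(g has_integral pi * (c n - (c (n - 1) + c (n + 1)) / 2)) {0..pi}"
    using has_integral_fourier_second_difference[OF c(1) n] unfolding \<psi> g_def .
  define x where "x = 1 - r"
  define e where "e = exp (- (real k / (4 * C)))"
  define B where "B = ((C - 1) / C) ^ (k - 2) * exp (4 / (C - 1))"
  define \<theta>i where "\<theta>i = \<kappa> * x / w ^ 3"
  define \<theta>0 where "\<theta>0 = \<kappa> * x / w\<^sup>2"
  \<comment> \<open>If \<open>k^2 * x\<close> exceeds \<open>pi\<close>, there is no far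
    arc.\<close>
  define T where "T = min (real k ^ 2 * x) pi"
  \<comment> \<open>Chosen so that \<open>6 / V ^ 3 = 2 * E / \<theta> ^ 6\<close> for the Gaussian
    exponent \<open>V\<close> below; the weight \<open>\<theta>\<^sup>2 / 2\<close> then leaves
    \<open>E / \<theta> ^ 4\<close>.\<close>
  define E where "E = 12288 * C ^ 3 * x ^ 6 / w ^ 18"
  define S where "S = (\<Sum>j. (prob r j)\<^sup>2)"
  have x: "0 < x" "x < 1" using r by (auto simp: x_def)
  have pos: "0 < e" "0 \<le> B" "0 < E" using x w C_gt_one by (auto simp: e_def B_def E_def)
  have w2: "1 \<le> w\<^sup>2" using w by simp
  have "w\<^sup>2 * 1 \<le> w\<^sup>2 * w" using w by (intro mult_left_mono) auto
  then have w23: "w\<^sup>2 \<le> w ^ 3" by (simp add: power2_eq_square power3_eq_cube)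
  have \<theta>i0: "0 < \<theta>i" "\<theta>i \<le> \<theta>0" "0 < \<theta>0"
    using kappa_bounds x w w2 w23 by (auto simp: \<theta>i_def \<theta>0_def intro!: divide_left_mono)
  have "\<theta>0 \<le> \<kappa> * x / 1" unfolding \<theta>0_def using w2 kappa_bounds x by (intro divide_left_mono) auto
  also have "\<dots> \<le> 1 * 1" unfolding div_by_1 using kappa_bounds x by (intro mult_mono) auto
  finally have \<theta>01: "\<theta>0 \<le> pi" using pi_ge_two by linarith
  have T: "0 \<le> T" "T \<le> pi" "T \<le> real k ^ 2 * x" using x by (auto simp: T_def)
  \<comment> \<open>One positive piece on the core and three error terms. The last two errors are
    subtracted beyond their own arcs as well, which only lowers the minorant.\<close>
  define h where "h \<theta> = (if \<theta> \<in> {0..\<theta>i} then 1 / 32 * \<theta>\<^sup>2 else 0) - (if \<theta> \<in> {\<theta>0..pi} then E / \<theta> ^ 4 else 0)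
     - (if \<theta> \<in> {0..T} then e / 2 * \<theta>\<^sup>2 else 0) - 2 * B * (norm (fourier (prob r) \<theta>))\<^sup>2" for \<theta>
  have hint: "(h has_integral 1 / 32 * \<theta>i ^ 3 / 3 - (E / (3 * \<theta>0 ^ 3) - E / (3 * pi ^ 3)) - e / 2 * T ^ 3 / 3
     - 2 * B * (pi * S)) {0..pi}"
    unfolding h_def S_def using \<theta>i0 \<theta>01 T r
    by (intro has_integral_diff has_integral_power2_restrict has_integral_inverse_power4_restrict
      has_integral_mult_right has_integral_norm_fourier_squared summable_abs_prob) auto
  have hg: "h \<theta> \<le> g \<theta>" if \<theta>: "\<theta> \<in> {0..pi}" for \<theta>
  proof -
    have cos: "\<theta>\<^sup>2 / 8 \<le> 1 - cos \<theta>" "1 - cos \<theta> \<le> \<theta>\<^sup>2 / 2" "0 \<le> 1 - cos \<theta>" "1 - cos \<theta> \<le> 2"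
      using one_minus_cos_ge[of \<theta>] one_minus_cos_le[of \<theta>] \<theta> cos_ge_minus_one[of \<theta>] by (auto simp del: cos_ge_minus_one)
    have hle: "h \<theta> \<le> (if \<theta> \<in> {0..\<theta>i} then 1 / 32 * \<theta>\<^sup>2 else 0)"
      unfolding h_def using pos by (auto intro!: add_nonneg_nonneg simp: diff_le_eq)
    show ?thesis
    proof (cases "\<theta> \<le> \<theta>0")
      case True
      have k1: "k \<ge> 1" using k by simp
      have ge0: "0 \<le> Re (\<psi> \<theta> ^ k)"
        unfolding \<psi>_def using True \<theta> by (intro central_arc(1)[OF r k1 w mean]) (auto simp: \<theta>0_def x_def)
      show ?thesis
      proof (cases "\<theta> \<le> \<theta>i")
        case True
        have "1 / 4 \<le> Re (\<psi> \<theta> ^ k)"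
          unfolding \<psi>_def using \<open>\<theta> \<le> \<theta>0\<close> True \<theta>
          by (intro central_arc(2)[OF r k1 w mean]) (auto simp: \<theta>0_def \<theta>i_def x_def)
        then have "1 / 4 * (\<theta>\<^sup>2 / 8) \<le> g \<theta>" unfolding g_def using cos by (intro mult_mono) auto
        then show ?thesis using hle True \<theta> by simp
      next
        case False
        have "0 \<le> g \<theta>" unfolding g_def using ge0 cos by simp
        then show ?thesis using hle False by simp
      qed
    next
      case False
      have npsi: "norm (\<psi> \<theta> ^ k) = norm (fourier (prob r) \<theta>) ^ k"
        by (simp add: \<psi>_def norm_power norm_mult)
      have "- Re (\<psi> \<theta> ^ k) \<le> norm (fourier (prob r) \<theta>) ^ k"
        using abs_Re_le_cmod[of "\<psi> \<theta> ^ k"] unfolding npsi by linarith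
      from mult_right_mono[OF this cos(3)] have g: "- g \<theta> \<le> norm (fourier (prob r) \<theta>) ^ k * (1 - cos \<theta>)"
        by (simp add: g_def)
      show ?thesis
      proof (cases "\<theta> \<le> T")
        case True
        define V where "V = real k * r * \<theta>\<^sup>2 / (16 * C * (1 - r)\<^sup>2)"
        have V: "0 < V" unfolding V_def using r k False \<theta>i0 C_gt_one by (intro divide_pos_pos mult_pos_pos) auto
        have "V ^ 3 / 6 \<le> exp V" using power_over_fact_le_exp[of V 3] V by (simp add: fact_numeral)
        then have "exp (- V) \<le> 6 / V ^ 3" using V by (simp add: exp_minus field_simps)
        also have "\<dots> = 2 * E / \<theta> ^ 6"
          unfolding V_def E_def w(2)[symmetric] x_def[symmetric] using x w(1) C_gt_one False \<theta>i0
          by (simp add: power_divide power_mult_distrib flip: power_mult)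
        finally have "norm (fourier (prob r) \<theta>) ^ k \<le> 2 * E / \<theta> ^ 6 + e"
          using norm_fourier_power_le[OF r, of \<theta> k] \<theta> by (simp add: V_def e_def)
        then have "norm (fourier (prob r) \<theta>) ^ k * (1 - cos \<theta>) \<le> (2 * E / \<theta> ^ 6 + e) * (\<theta>\<^sup>2 / 2)"
          using cos pos by (intro mult_mono) auto
        also have "\<dots> = E / \<theta> ^ 4 + e / 2 * \<theta>\<^sup>2"
          using False \<theta>i0 by (simp add: field_simps eval_nat_numeral)
        finally have "- g \<theta> \<le> E / \<theta> ^ 4 + e / 2 * \<theta>\<^sup>2" using g by linarith
        moreover have "h \<theta> \<le> - (E / \<theta> ^ 4) - e / 2 * \<theta>\<^sup>2"
          unfolding h_def using False True \<theta> \<theta>i0 pos by auto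
        ultimately show ?thesis by linarith
      next
        case False
        then have "real k ^ 2 * (1 - r) \<le> \<theta>" using \<theta> by (simp add: T_def x_def min_def split: if_splits)
        then have "norm (fourier (prob r) \<theta>) ^ k \<le> B * (norm (fourier (prob r) \<theta>))\<^sup>2"
          unfolding B_def using \<theta> by (intro norm_fourier_power_le_far[OF r k]) auto
        then have "norm (fourier (prob r) \<theta>) ^ k * (1 - cos \<theta>) \<le> B * (norm (fourier (prob r) \<theta>))\<^sup>2 * 2"
          using cos pos by (intro mult_mono) auto
        with g have "- g \<theta> \<le> 2 * B * (norm (fourier (prob r) \<theta>))\<^sup>2" by simp
        moreover have "h \<theta> \<le> - (2 * B * (norm (fourier (prob r) \<theta>))\<^sup>2)"
          unfolding h_def using \<open>\<not> \<theta> \<le> \<theta>0\<close> False \<theta> \<theta>i0 pos by auto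
        ultimately show ?thesis by linarith
      qed
    qed
  qed
  \<comment> \<open>\<open>U\<close> is a common unit: the core contributes \<open>3 * U\<close> and
    each of the three errors costs at most \<open>U\<close>.\<close>
  define U where "U = \<kappa> ^ 3 * x ^ 3 / (288 * w ^ 9)"
  have "(w ^ 9)\<^sup>2 = (w ^ 6) ^ 3" by (simp flip: power_mult)
  also have "\<dots> = real k ^ 3 * r ^ 3" by (simp add: w power_mult_distrib)
  also have "\<dots> \<le> real k ^ 3 * real k" using r k power_le_one[of r 3] by (intro mult_left_mono) auto
  also have "\<dots> = (real k ^ 2)\<^sup>2" by (simp add: eval_nat_numeral)
  finally have w9: "w ^ 9 \<le> real k ^ 2" by (rule power2_le_imp_le) simp
  have w0: "w > 0" using w by simp
  have t1: "1 / 32 * \<theta>i ^ 3 / 3 = 3 * U"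
    using w0 by (simp add: \<theta>i_def U_def power_mult_distrib power_divide flip: power_mult)
  have "E / (3 * \<theta>0 ^ 3) = 288 * 4096 * C ^ 3 / \<kappa> ^ 6 / w ^ 3 * U"
    using w0 kappa_bounds(1) x by (simp add: E_def \<theta>0_def U_def field_simps eval_nat_numeral)
  also have "\<dots> \<le> 1 * U"
    using w_large w0 x kappa_bounds(1) by (intro mult_right_mono) (auto simp: U_def divide_le_eq mult.commute)
  finally have t2: "E / (3 * \<theta>0 ^ 3) \<le> U" by simp
  have kw: "real k ^ 6 * w ^ 9 \<le> real k ^ 8"
    using mult_left_mono[OF w9, of "real k ^ 6"] by (simp flip: power_add)
  \<comment> \<open>The power \<open>k ^ 8\<close> in \<open>exp_small\<close> arises from
    \<open>k ^ 6\<close> here and from \<open>w ^ 9 \<le> real k ^ 2\<close>.\<close>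
  have "T ^ 3 \<le> (real k ^ 2 * x) ^ 3" using T by (intro power_mono) auto
  then have "e / 2 * T ^ 3 / 3 * w ^ 9 \<le> e / 2 * (real k ^ 2 * x) ^ 3 / 3 * w ^ 9"
    using pos w0 by (intro mult_right_mono divide_right_mono mult_left_mono) auto
  also have "\<dots> = (real k ^ 6 * w ^ 9) * (e * x ^ 3 / 6)" by (simp add: power_mult_distrib flip: power_mult)
  also have "\<dots> \<le> real k ^ 8 * (e * x ^ 3 / 6)" using kw pos x by (intro mult_right_mono) auto
  also have "\<dots> = (real k ^ 8 * e / 6) * x ^ 3" by simp
  also have "\<dots> \<le> (\<kappa> ^ 3 / 288) * x ^ 3" using exp_small x unfolding e_def by (intro mult_right_mono) auto
  also have "\<dots> = U * w ^ 9" using w0 by (simp add: U_def)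
  finally have t3: "e / 2 * T ^ 3 / 3 \<le> U" using w0 by simp
  have "S \<le> (C + D) * x powr (1 - \<alpha>)" unfolding S_def x_def by (rule suminf_prob_squared_le[OF r])
  \<comment> \<open>The core is of order \<open>x ^ 3\<close>, so relative to it the Parseval bound
    costs \<open>x powr (- (2 + \<alpha>))\<close>. This is the source of the exponent
    \<open>1 / (2 + \<alpha>)\<close> in \<open>A\<close>.\<close>
  also have "x powr (1 - \<alpha>) = x ^ 3 * x powr (- (2 + \<alpha>))"
    using x powr_add[of x 3 "- (2 + \<alpha>)"] by simp
  finally have S: "S \<le> (C + D) * (x ^ 3 * x powr (- (2 + \<alpha>)))" .
  have S0: "0 \<le> S" unfolding S_def
    using has_integral_norm_fourier_squared(2)[OF summable_abs_prob[of r]] r by (intro suminf_nonneg) auto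
  have "2 * B * (pi * S) * w ^ 9 \<le> 2 * B * (4 * ((C + D) * (x ^ 3 * x powr (- (2 + \<alpha>))))) * real k ^ 2"
    using S S0 pi_less_4 w9 w0 pos C_gt_one D_pos x by (intro mult_mono mult_nonneg_nonneg) auto
  also have "\<dots> = (8 * B * (C + D) * real k ^ 2 * (1 - r) powr (- (2 + \<alpha>))) * x ^ 3"
    by (simp add: x_def mult_ac)
  also have "\<dots> \<le> (\<kappa> ^ 3 / 288) * x ^ 3" using tail_small x unfolding B_def by (intro mult_right_mono) auto
  also have "\<dots> = U * w ^ 9" using w0 by (simp add: U_def)
  finally have t4: "2 * B * (pi * S) \<le> U" using w0 by simp
  have "0 \<le> 1 / 32 * \<theta>i ^ 3 / 3 - (E / (3 * \<theta>0 ^ 3) - E / (3 * pi ^ 3)) - e / 2 * T ^ 3 / 3 - 2 * B * (pi * S)"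
  proof -
    have "0 \<le> E / (3 * pi ^ 3)" using pos by simp
    with t1 t2 t3 t4 show ?thesis by linarith
  qed
  also have "\<dots> \<le> pi * (c n - (c (n - 1) + c (n + 1)) / 2)"
    using hg by (intro has_integral_le[OF hint J]) auto
  finally have "0 \<le> c n - (c (n - 1) + c (n + 1)) / 2"
    unfolding zero_le_mult_iff using pi_gt_zero by linarith
  then have "c (n - 1) + c (n + 1) \<le> 2 * c n" by simp
  then have "(c (n - 1) + c (n + 1)) * gf r ^ k \<le> 2 * c n * gf r ^ k"
    using gf_pos[of r] r by (intro mult_right_mono) auto
  then show ?thesis using gf_pos[of r] r by (simp add: c_def distrib_right)
qed

end

section \<open>Location of the saddle point, choice of the thresholds and log-concavity\<close>

lemma one_plus_powr_le:
  fixes u \<alpha> :: real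
  assumes "0 \<le> u" "0 \<le> \<alpha>" "\<alpha> \<le> 1"
  shows "(1 + u) powr (2 + \<alpha>) \<le> 8 * (1 + u powr (2 + \<alpha>))"
proof -
  have "(2::real) powr (2 + \<alpha>) \<le> 2 powr 3" using assms by (intro powr_mono) auto
  then have 8: "(2::real) powr (2 + \<alpha>) \<le> 8" by simp
  have "(1 + u) powr (2 + \<alpha>) \<le> (2 * max 1 u) powr (2 + \<alpha>)"
    using assms by (intro powr_mono2) auto
  also have "\<dots> = 2 powr (2 + \<alpha>) * max 1 u powr (2 + \<alpha>)" by (simp add: powr_mult)
  also have "\<dots> \<le> 8 * max 1 u powr (2 + \<alpha>)" using 8 by (intro mult_right_mono) auto
  also have "max 1 u powr (2 + \<alpha>) \<le> 1 + u powr (2 + \<alpha>)" by (auto simp: max_def)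
  finally show ?thesis by simp
qed

context almost_linear_sums
begin

text \<open>A rearrangement of \<open>mean_ge\<close> that limits how close the saddle point can
  come to \<open>1\<close>.\<close>

lemma one_minus_saddle_ge:
  assumes r: "0 < r" "r < 1" and k: "k \<ge> 1"
    and mean: "(\<lambda>j. real j * prob r j) sums (real n / real k)"
  shows "1 \<le> (1 - r) * (1 + real n * C / real k)"
proof -
  have "r / (C * (1 - r)) \<le> real n / real k" using mean_ge[OF r] mean by (simp add: sums_iff)
  then have "r \<le> real n / real k * (C * (1 - r))" using r C_gt_one by (simp add: pos_divide_le_eq)
  then show ?thesis by (simp add: algebra_simps)
qed

text \<open>By \<open>A powr (2 + \<alpha>) = 1 / q\<close>, the range of \<open>n\<close> bounds
  \<open>(1 - r) powr (- (2 + \<alpha>))\<close> by a constant plus a term of order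
  \<open>1 / (q ^ k * k ^ 6)\<close>. The factor \<open>q ^ k\<close> cancels the exponential
  growth, and the denominator \<open>k^2\<close> in the range of \<open>n\<close> is what makes the
  remainder decay.\<close>

lemma far_tail_le:
  fixes k n :: nat
  assumes r: "0 < r" "r < 1" and k: "k \<ge> 4"
    and mean: "(\<lambda>j. real j * prob r j) sums (real n / real k)"
    and n: "real n \<le> ((C / (C - 1)) powr (1 / (2 + \<alpha>))) ^ k / real k ^ 2"
  defines "q \<equiv> (C - 1) / C"
  shows "8 * (q ^ (k - 2) * exp (4 / (C - 1))) * (C + D) * real k ^ 2 * (1 - r) powr (- (2 + \<alpha>))
    \<le> 64 * exp (4 / (C - 1)) * (C + D) / q\<^sup>2 * (real k ^ 2 * q ^ k + C ^ 3 / real k ^ 4)"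
proof -
  define A where "A = (C / (C - 1)) powr (1 / (2 + \<alpha>))"
  \<comment> \<open>The largest value of \<open>real n * C / real k\<close> that the hypothesis on
    \<open>n\<close> permits.\<close>
  define u where "u = C * A ^ k / real k ^ 3"
  have q: "0 < q" using C_gt_one by (simp add: q_def)
  have k0: "real k \<ge> 1" "k \<ge> 1" using k by auto
  have A: "0 < A" "A powr (2 + \<alpha>) = 1 / q"
    using C_gt_one \<alpha>_nonneg by (auto simp: A_def powr_powr q_def)
  have u: "0 < u" using A C_gt_one k by (simp add: u_def)
  have "real n * C / real k \<le> (A ^ k / real k ^ 2) * C / real k"
    using n C_gt_one k0 unfolding A_def by (intro divide_right_mono mult_right_mono) auto
  also have "\<dots> = u" by (simp add: u_def power2_eq_square power3_eq_cube)
  finally have "(1 - r) * (1 + real n * C / real k) \<le> (1 - r) * (1 + u)"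
    using r by (intro mult_left_mono) auto
  with one_minus_saddle_ge[OF r k0(2) mean] have "1 \<le> (1 - r) * (1 + u)" by linarith
  then have "1 / (1 + u) \<le> 1 - r" using u by (simp add: field_simps)
  then have "(1 - r) powr (- (2 + \<alpha>)) \<le> (1 / (1 + u)) powr (- (2 + \<alpha>))"
    using u \<alpha>_nonneg by (intro powr_mono2') auto
  also have "1 / (1 + u) = (1 + u) powr (- 1)" using u by (simp add: powr_minus_divide)
  also have "((1 + u) powr (- 1)) powr (- (2 + \<alpha>)) = (1 + u) powr (2 + \<alpha>)"
    unfolding powr_powr by (simp add: add.commute)
  also have "\<dots> \<le> 8 * (1 + u powr (2 + \<alpha>))"
    using u \<alpha>_nonneg \<alpha>_less_one by (intro one_plus_powr_le) auto
  also have "u powr (2 + \<alpha>) \<le> C ^ 3 / (q ^ k * real k ^ 6)"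
  proof -
    have "(A ^ k) powr (2 + \<alpha>) = (A powr (2 + \<alpha>)) ^ k"
      using A(1) by (simp add: powr_powr mult.commute flip: powr_realpow)
    then have "u powr (2 + \<alpha>) = C powr (2 + \<alpha>) * (1 / q) ^ k / (real k ^ 3) powr (2 + \<alpha>)"
      unfolding u_def using C_gt_one A k0 by (simp add: powr_mult powr_divide)
    also have "\<dots> \<le> C ^ 3 * (1 / q) ^ k / real k ^ 6"
    proof (intro frac_le mult_right_mono)
      have "C powr (2 + \<alpha>) \<le> C powr 3" using C_gt_one \<alpha>_less_one by (intro powr_mono) auto
      then show "C powr (2 + \<alpha>) \<le> C ^ 3" using C_gt_one by simp
      have "(real k ^ 3) powr 2 \<le> (real k ^ 3) powr (2 + \<alpha>)"
        using k0 \<alpha>_nonneg by (intro powr_mono) auto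
      then show "real k ^ 6 \<le> (real k ^ 3) powr (2 + \<alpha>)" using k0 by (simp flip: power_mult)
    qed (use q k0 C_gt_one in auto)
    finally show ?thesis by (simp add: power_one_over field_simps)
  qed
  finally have "(1 - r) powr (- (2 + \<alpha>)) \<le> 8 * (1 + C ^ 3 / (q ^ k * real k ^ 6))" by simp
  then have "8 * (q ^ (k - 2) * exp (4 / (C - 1))) * (C + D) * real k ^ 2 * (1 - r) powr (- (2 + \<alpha>))
    \<le> 8 * (q ^ (k - 2) * exp (4 / (C - 1))) * (C + D) * real k ^ 2 * (8 * (1 + C ^ 3 / (q ^ k * real k ^ 6)))"
    using q C_gt_one D_pos by (intro mult_left_mono) auto
  also have "8 * (q ^ (k - 2) * exp (4 / (C - 1))) * (C + D) * real k ^ 2 * (8 * (1 + C ^ 3 / (q ^ k * real k ^ 6)))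
     = 64 * exp (4 / (C - 1)) * (C + D) / q\<^sup>2 * (real k ^ 2 * (q ^ k * (1 + C ^ 3 / (q ^ k * real k ^ 6))))"
  proof -
    have "q ^ (k - 2) = q ^ k / q\<^sup>2" using q k by (simp add: power_diff)
    then show ?thesis by simp
  qed
  also have "real k ^ 2 * (q ^ k * (1 + C ^ 3 / (q ^ k * real k ^ 6))) = real k ^ 2 * q ^ k + C ^ 3 / real k ^ 4"
  proof -
    have "real k ^ 2 * C ^ 3 / real k ^ 6 = C ^ 3 / real k ^ 4"
      using k0 by (simp add: divide_eq_eq eq_divide_eq mult_ac flip: power_add)
    then show ?thesis using q k0 by (simp add: distrib_left)
  qed
  finally show ?thesis .
qed

text \<open>The saddle point estimate needs \<open>k * r\<close> large. For
  \<open>r \<le> 1 / 2\<close> the bound on the mean makes \<open>k * r\<close> at least a constant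
  times \<open>n\<close>, which requires \<open>n\<close> large; for other \<open>r\<close> it
  exceeds \<open>k / 2\<close>. The threshold \<open>N\<close> does not depend on
  \<open>k\<close>.\<close>

lemma eventually_log_concave_large_index:
  obtains N where "\<forall>\<^sub>F k in sequentially. \<forall>n\<ge>N. real n \<le> ((C / (C - 1)) powr (1 / (2 + \<alpha>))) ^ k / real k ^ 2 \<longrightarrow>
    fps_nth (Abs_fps a ^ k) (n - 1) * fps_nth (Abs_fps a ^ k) (n + 1) \<le> (fps_nth (Abs_fps a ^ k) n)\<^sup>2"
proof -
  define q where "q = (C - 1) / C"
  define M where "M = 64 * exp (4 / (C - 1)) * (C + D) / q\<^sup>2"
  \<comment> \<open>A lower bound for \<open>w\<close>; since it is at least \<open>1\<close>,
    \<open>w \<le> w ^ 3\<close> turns it into the hypothesis on \<open>w ^ 3\<close>.\<close>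
  define L where "L = max 1 (288 * 4096 * C ^ 3 / \<kappa> ^ 6)"
  obtain N0 where N0: "2 * (576 * C) * L ^ 6 \<le> real N0" using real_arch_simple by blast
  obtain k0 where k0: "2 * L ^ 6 \<le> real k0" using real_arch_simple by blast
  have q: "0 < q" "q < 1" using C_gt_one by (auto simp: q_def)
  have kap: "0 < \<kappa> ^ 3 / 288" using kappa_bounds(1) by simp
  have C0: "0 < C" using C_gt_one by simp
  have "\<forall>\<^sub>F k in sequentially. real k ^ 8 * exp (- (real k / (4 * C))) / 6 < \<kappa> ^ 3 / 288"
    by (rule order_tendstoD(2)[OF tendsto_power8_mult_exp[OF C0] kap])
  moreover have "\<forall>\<^sub>F k in sequentially. M * (real k ^ 2 * q ^ k + C ^ 3 / real k ^ 4) < \<kappa> ^ 3 / 288"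
    by (rule order_tendstoD(2)[OF tendsto_power2_mult_power_plus[OF q] kap])
  ultimately have "\<forall>\<^sub>F k in sequentially. \<forall>n\<ge>Suc N0. real n \<le> ((C / (C - 1)) powr (1 / (2 + \<alpha>))) ^ k / real k ^ 2 \<longrightarrow>
    fps_nth (Abs_fps a ^ k) (n - 1) * fps_nth (Abs_fps a ^ k) (n + 1) \<le> (fps_nth (Abs_fps a ^ k) n)\<^sup>2"
    using eventually_ge_at_top[of 4] eventually_ge_at_top[of k0]
  proof eventually_elim
    case (elim k)
    show ?case
    proof (intro allI impI)
      fix n assume nN: "Suc N0 \<le> n" and n: "real n \<le> ((C / (C - 1)) powr (1 / (2 + \<alpha>))) ^ k / real k ^ 2"
      have n1: "1 \<le> n" using nN by simp
      have k4: "k \<ge> 4" by fact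
      obtain r where r: "0 < r" "r < 1" and mean: "(\<lambda>j. real j * prob r j) sums (real n / real k)"
        using saddle_point[of "real n / real k"] n1 k4 by auto
      have kr: "L ^ 6 \<le> real k * r"
      proof (cases "r \<le> 1 / 2")
        case True
        have "real n / real k \<le> 576 * C * r / (1 - r)"
          using moment(2)[of r 1] r mean by (simp add: sums_iff)
        also have "\<dots> \<le> 576 * C * r / (1 / 2)" using True r C0 by (intro divide_left_mono) auto
        finally have "real n \<le> 2 * (576 * C) * (real k * r)" using k4 by (simp add: field_simps)
        moreover have "2 * (576 * C) * L ^ 6 \<le> real n" using N0 nN by simp
        ultimately have "2 * (576 * C) * L ^ 6 \<le> 2 * (576 * C) * (real k * r)" by linarith
        then show ?thesis using C0 by simp
      next
        case False
        have "real k * (1 / 2) \<le> real k * r" using False by (intro mult_left_mono) auto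
        moreover have "2 * L ^ 6 \<le> real k" using k0 elim by simp
        ultimately show ?thesis by linarith
      qed
      define w where "w = root 6 (real k * r)"
      have w6: "w ^ 6 = real k * r" using r by (simp add: w_def)
      have L1: "1 \<le> L" by (simp add: L_def)
      have "root 6 (L ^ 6) \<le> w" unfolding w_def using kr by simp
      then have wL: "L \<le> w" using L1 by (simp add: real_root_power_cancel)
      then have w1: "1 \<le> w" using L1 by simp
      have "w * 1 \<le> w * w\<^sup>2" using w1 by (intro mult_left_mono) auto
      then have "w \<le> w ^ 3" by (simp add: power2_eq_square power3_eq_cube)
      then have wL3: "288 * 4096 * C ^ 3 / \<kappa> ^ 6 \<le> w ^ 3" using wL by (simp add: L_def)
      define A where "A = (\<lambda>j. fps_nth (Abs_fps a ^ k) j)"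
      have A0: "0 \<le> A j" for j
        unfolding A_def using fourier_fps_power(1)[of a r k] coeff_nonneg r summable_gf[of r] by simp
      have "A (n - 1) * r ^ (n - 1) + A (n + 1) * r ^ (n + 1) \<le> 2 * (A n * r ^ n)"
        unfolding A_def
      proof (rule second_difference_nonpos[OF r k4 w1 w6 n1 mean wL3])
        show "real k ^ 8 * exp (- (real k / (4 * C))) / 6 \<le> \<kappa> ^ 3 / 288" using elim by simp
        show "8 * (((C - 1) / C) ^ (k - 2) * exp (4 / (C - 1))) * (C + D) * real k ^ 2 * (1 - r) powr (- (2 + \<alpha>)) \<le> \<kappa> ^ 3 / 288"
          using far_tail_le[OF r k4 mean n] elim by (simp add: M_def q_def)
      qed
      then have "(A (n - 1) * r ^ (n - 1) + A (n + 1) * r ^ (n + 1))\<^sup>2 \<le> (2 * (A n * r ^ n))\<^sup>2"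
        using A0 r by (intro power_mono) auto
      \<comment> \<open>AM-GM turns the second difference inequality into log-concavity; the powers
        of \<open>r\<close> on both sides then agree and cancel.\<close>
      moreover have "4 * (x * y) \<le> (x + y)\<^sup>2" for x y :: real
        using zero_le_power2[of "x - y"] by (simp add: power2_eq_square algebra_simps)
      ultimately have "4 * ((A (n - 1) * r ^ (n - 1)) * (A (n + 1) * r ^ (n + 1))) \<le> (2 * (A n * r ^ n))\<^sup>2"
        using order_trans by blast
      moreover have "r ^ (n - 1) * r ^ (n + 1) = (r ^ n)\<^sup>2"
      proof -
        have "n - 1 + (n + 1) = n * 2" using n1 by simp
        then show ?thesis by (simp only: power_add[symmetric] power_mult[symmetric])
      qed
      moreover have "(A (n - 1) * r ^ (n - 1)) * (A (n + 1) * r ^ (n + 1)) = (r ^ (n - 1) * r ^ (n + 1)) * (A (n - 1) * A (n + 1))"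
        by (simp only: mult_ac)
      ultimately have "4 * ((r ^ n)\<^sup>2 * (A (n - 1) * A (n + 1))) \<le> (2 * (A n * r ^ n))\<^sup>2" by (simp only:)
      then have "(r ^ n)\<^sup>2 * (A (n - 1) * A (n + 1)) \<le> (r ^ n)\<^sup>2 * (A n)\<^sup>2"
        by (simp add: power_mult_distrib mult_ac)
      then have "A (n - 1) * A (n + 1) \<le> (A n)\<^sup>2" using r by (simp add: mult_le_cancel_left)
      then show "fps_nth (Abs_fps a ^ k) (n - 1) * fps_nth (Abs_fps a ^ k) (n + 1) \<le> (fps_nth (Abs_fps a ^ k) n)\<^sup>2"
        by (simp add: A_def)
    qed
  qed
  then show ?thesis by (rule that)
qed

text \<open>Only finitely many positive indices lie below the threshold \<open>N\<close>, so their
  separate bounds on \<open>k\<close> combine into one.\<close>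

lemma eventually_log_concave:
  "\<forall>\<^sub>F k in sequentially. \<forall>n\<ge>1. real n \<le> ((C / (C - 1)) powr (1 / (2 + \<alpha>))) ^ k / real k ^ 2 \<longrightarrow>
    fps_nth (Abs_fps a ^ k) (n - 1) * fps_nth (Abs_fps a ^ k) (n + 1) \<le> (fps_nth (Abs_fps a ^ k) n)\<^sup>2"
proof -
  obtain N where large: "\<forall>\<^sub>F k in sequentially. \<forall>n\<ge>N. real n \<le> ((C / (C - 1)) powr (1 / (2 + \<alpha>))) ^ k / real k ^ 2 \<longrightarrow>
    fps_nth (Abs_fps a ^ k) (n - 1) * fps_nth (Abs_fps a ^ k) (n + 1) \<le> (fps_nth (Abs_fps a ^ k) n)\<^sup>2"
    by (rule eventually_log_concave_large_index)
  have a: "a 0 > 0" "a 1 > 0" using coeff_ge_one[of 0] coeff_ge_one[of 1] by auto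
  have "\<forall>\<^sub>F k in sequentially. \<forall>n\<in>{1..<N}.
    fps_nth (Abs_fps a ^ k) (n - 1) * fps_nth (Abs_fps a ^ k) (n + 1) \<le> (fps_nth (Abs_fps a ^ k) n)\<^sup>2"
    by (intro eventually_ball_finite ballI eventually_fps_power_log_concave_at a) auto
  with large show ?thesis
  proof eventually_elim
    case (elim k)
    then show ?case by (metis atLeastLessThan_iff not_less)
  qed
qed

end

theorem theorem1p4:
  fixes f :: "real fps" and a :: "nat \<Rightarrow> real" and C D \<alpha> A :: real
  assumes "f = Abs_fps a"
    and "\<And>n. a n \<ge> 1"
    and "C > 1" and "D > 0" and "0 \<le> \<alpha>" and "\<alpha> < 1"
    and "\<And>n. 0 \<le> C * real (n + 1) - (\<Sum>i\<le>n. a i)"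
    and "\<And>n. C * real (n + 1) - (\<Sum>i\<le>n. a i) \<le> D * real (n + 1) powr \<alpha>"
    and "A = (C / (C - 1)) powr (1 / (2 + \<alpha>))"
  shows "eventually (\<lambda>k::nat. \<forall>n::int. 0 \<le> n \<and> real_of_int n \<le> A ^ k / real k ^ 2 \<longrightarrow>
           (power_coeff f k n)\<^sup>2 \<ge> power_coeff f k (n - 1) * power_coeff f k (n + 1)) sequentially"
proof -
  interpret almost_linear_sums a C D \<alpha>
  proof unfold_locales
    show "(\<Sum>i\<le>n. a i) \<le> C * real (n + 1)" for n using assms(7)[of n] by simp
    show "C * real (n + 1) - D * real (n + 1) powr \<alpha> \<le> (\<Sum>i\<le>n. a i)" for n
      using assms(8)[of n] by simp
  qed (use assms in auto)
  from eventually_log_concave show ?thesis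
  proof eventually_elim
    case (elim k)
    show ?case
    proof (intro allI impI)
      fix n :: int assume n: "0 \<le> n \<and> real_of_int n \<le> A ^ k / real k ^ 2"
      show "power_coeff f k (n - 1) * power_coeff f k (n + 1) \<le> (power_coeff f k n)\<^sup>2"
      proof (cases "n = 0")
        case True
        \<comment> \<open>The coefficient at index \<open>-1\<close> is \<open>0\<close>, so the
          product vanishes.\<close>
        then show ?thesis by (simp add: power_coeff_def)
      next
        case False
        define m where "m = nat n"
        have m: "m \<ge> 1" "n = int m" using False n by (auto simp: m_def)
        have "fps_nth (f ^ k) (m - 1) * fps_nth (f ^ k) (m + 1) \<le> (fps_nth (f ^ k) m)\<^sup>2"
          using elim m n unfolding assms(1,9) by simp
        moreover have "nat (n - 1) = m - 1" "nat (n + 1) = m + 1" using m by auto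
        ultimately show ?thesis using m by (simp add: power_coeff_def)
      qed
    qed
  qed
qed

end
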